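(* Every Grandis exact category in the ordinary sense, regarded as a locally discrete 2-category, is Grandis 2-exact. Every Puppe exact category in the ordinary sense, and thus every abelian category, regarded as a locally discrete 2-category, is Puppe 2-exact.
   Context: Ordinary notions. An ideal of null morphisms in a category is a class of morphisms closed under composition on either side with arbitrary morphisms. Relative to an ideal, a kernel of $f$ is a morphism $k$ with $fk$ null such that every $z$ with $fz$ null factors uniquely through $k$; cokernels are dual. An ideal is closed if every null morphism factors through an object whose identity is null (in the presence of all kernels and cokernels: kernels reflect, equivalently cokernels coreflect, null morphisms). A Grandis exact category is a category for which there is a closed ideal such that all kernels and cokernels exist and every morphism factors as a cokernel followed by a kernel. A Puppe exact category is a category with zero object satisfying this for the ideal of zero morphisms. A locally discrete 2-category is one whose only 2-cells are identities. 2-ideals (2-categories are strict; whiskering by juxtaposition; chains of 2-cells denote vertical composites). A 2-ideal $\mathcal N=(N,\nu)$ in a 2-category $\mathfrak L$ is a normal pseudofunctor $N\colon\mathfrak L^{op}\times\mathfrak L\to\mathbf{Cat}$ with a pseudonatural transformation $\nu\colon N\Rightarrow\mathrm{Hom}(-,-)$ whose components are injective on objects and faithful. View $N(A,B)$ as a subcategory of $\mathrm{Hom}(A,B)$: its objects are the null morphisms, its morphisms the null 2-cells; an invertible null 2-cell is an isomorphism of $N(A,B)$. For $n\colon A\to B$ null, $a\colon A'\to A$, $b\colon B\to B'$, put $\widetilde{bna}:=N(a,b)(n)$ and let $\nu\colon bna\Rightarrow\widetilde{bna}$ be the invertible 2-cell given by pseudonaturality. 2-kernels. An $\mathcal N$-2-kernel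 of $f\colon A\to B$ is $k\colon K\to A$ with a null $n$ and an invertible $\alpha\colon fk\Rightarrow n$ such that: (1) for every $z\colon Z\to A$, null $p$ and invertible $\beta\colon fz\Rightarrow p$ there are $u\colon Z\to K$ and an invertible $\gamma\colon z\Rightarrow ku$ such that $p\xrightarrow{\beta^{-1}}fz\xrightarrow{f\gamma}fku\xrightarrow{\alpha u}nu\xrightarrow{\nu}\widetilde{nu}$ is an invertible null 2-cell; (2) for all $u,v\colon Z\to K$ and $\lambda\colon ku\Rightarrow kv$ such that $\widetilde{nu}\xrightarrow{\nu^{-1}}nu\xrightarrow{\alpha^{-1}u}fku\xrightarrow{f\lambda}fkv\xrightarrow{\alpha v}nv\xrightarrow{\nu}\widetilde{nv}$ is null, there is a unique $\mu\colon u\Rightarrow v$ with $k\mu=\lambda$. $\mathcal N$-2-cokernels are dual. Closed 2-ideals. $k\colon K\to A$ reflects null morphisms if for all $s\colon D\to K$, null $n$ and invertible $\delta\colon ks\Rightarrow n$ there are a null $\hat\psi$ and an invertible $\psi\colon s\Rightarrow\hat\psi$ such that $n\xrightarrow{\delta^{-1}}ks\xrightarrow{k\psi}k\hat\psi\xrightarrow{\nu}\widetilde{k\hat\psi}$ is an invertible null 2-cell; it reflects null 2-cells if every 2-cell $\mu\colon s\Rightarrow s'$ between null morphisms into $K$ such that $\widetilde{ks}\xrightarrow{\nu^{-1}}ks\xrightarrow{k\mu}ks'\xrightarrow{\nu}\widetilde{ks'}$ is null is itself null. $\mathcal N$ is closed if all $\mathcal N$-2-kernels reflect, and (dually) all $\mathcal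 N$-2-cokernels coreflect, null morphisms and null 2-cells. Grandis 2-exact: $\mathfrak L$ has a closed 2-ideal $\mathcal N$ such that all $\mathcal N$-2-kernels and $\mathcal N$-2-cokernels exist; every $\mathcal N$-2-kernel $m$ is an $\mathcal N$-2-kernel of its $\mathcal N$-2-cokernel $c_m$, with structure 2-cell given up to an invertible null 2-cell by that of the 2-cokernel $c_m$ of $m$, and dually; every morphism is isomorphic to an $\mathcal N$-2-cokernel followed by an $\mathcal N$-2-kernel. Puppe 2-exact: $\mathfrak L$ has a bizero object $0$ (all $\mathfrak L(A,0)$, $\mathfrak L(0,A)$ equivalent to the terminal category) and these conditions hold for the 2-ideal $(0)$: null morphisms are those factoring as $A\xrightarrow{t}0\xrightarrow{i}B$; null 2-cells $it\Rightarrow i't'$ are the pastings of the unique 2-cells $t\Rightarrow t'$, $i\Rightarrow i'$; $\widetilde{bna}=bna$, $\nu=\mathrm{id}$. *)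

theory Defs
  imports "HOL-Algebra.Group"
begin

section \<open>Categories\<close>

record ('o, 'a) cat =
  Obj :: "'o set"
  Arr :: "'a set"
  Dom :: "'a \<Rightarrow> 'o"
  Cod :: "'a \<Rightarrow> 'o"
  Idt :: "'o \<Rightarrow> 'a"
  Comp :: "'a \<Rightarrow> 'a \<Rightarrow> 'a"  (infixl "\<cdot>\<index>" 70)

definition Hom :: "('o, 'a, 'm) cat_scheme \<Rightarrow> 'o \<Rightarrow> 'o \<Rightarrow> 'a set" where
  "Hom C A B = {f \<in> Arr C. Dom C f = A \<and> Cod C f = B}"

locale category =
  fixes C :: "('o, 'a, 'm) cat_scheme" (structure)
  assumes Dom_in_Obj: "f \<in> Arr C \<Longrightarrow> Dom C f \<in> Obj C"
    and Cod_in_Obj: "f \<in> Arr C \<Longrightarrow> Cod C f \<in> Obj C"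
    and Idt_in_Hom: "A \<in> Obj C \<Longrightarrow> Idt C A \<in> Hom C A A"
    and Comp_in_Hom: "f \<in> Hom C A B \<Longrightarrow> g \<in> Hom C B D \<Longrightarrow> g \<cdot> f \<in> Hom C A D"
    and Comp_Idt: "f \<in> Hom C A B \<Longrightarrow> f \<cdot> Idt C A = f"
    and Idt_Comp: "f \<in> Hom C A B \<Longrightarrow> Idt C B \<cdot> f = f"
    and Comp_assoc: "f \<in> Hom C A B \<Longrightarrow> g \<in> Hom C B D \<Longrightarrow> h \<in> Hom C D E \<Longrightarrow>
      h \<cdot> g \<cdot> f = h \<cdot> (g \<cdot> f)"

definition cat_op :: "('o, 'a) cat \<Rightarrow> ('o, 'a) cat" where
  "cat_op C = \<lparr>Obj = Obj C, Arr = Arr C, Dom = Cod C, Cod = Dom C, Idt = Idt C,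
     Comp = (\<lambda>g f. f \<cdot>\<^bsub>C\<^esub> g)\<rparr>"

definition Isos :: "('o, 'a, 'm) cat_scheme \<Rightarrow> 'o \<Rightarrow> 'o \<Rightarrow> 'a set" where
  "Isos C A B =
     {f \<in> Hom C A B. \<exists>g \<in> Hom C B A. g \<cdot>\<^bsub>C\<^esub> f = Idt C A \<and> f \<cdot>\<^bsub>C\<^esub> g = Idt C B}"

definition inverse_of :: "('o, 'a, 'm) cat_scheme \<Rightarrow> 'a \<Rightarrow> 'a" where
  "inverse_of C f = (THE g. g \<in> Hom C (Cod C f) (Dom C f) \<and>
     g \<cdot>\<^bsub>C\<^esub> f = Idt C (Dom C f) \<and> f \<cdot>\<^bsub>C\<^esub> g = Idt C (Cod C f))"

definition monic :: "('o, 'a) cat \<Rightarrow> 'a \<Rightarrow> bool" where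
  "monic C m \<longleftrightarrow> m \<in> Arr C \<and>
     (\<forall>Z. \<forall>u \<in> Hom C Z (Dom C m). \<forall>v \<in> Hom C Z (Dom C m). m \<cdot>\<^bsub>C\<^esub> u = m \<cdot>\<^bsub>C\<^esub> v \<longrightarrow> u = v)"

definition epic :: "('o, 'a) cat \<Rightarrow> 'a \<Rightarrow> bool" where
  "epic C e \<longleftrightarrow> monic (cat_op C) e"

subsection \<open>Functors and natural transformations\<close>

record ('x, 'y, 'u, 'v) fctr =
  OMap :: "'x \<Rightarrow> 'u"
  AMap :: "'y \<Rightarrow> 'v"

definition id_fctr :: "('x, 'y, 'x, 'y) fctr" where
  "id_fctr = \<lparr>OMap = (\<lambda>x. x), AMap = (\<lambda>f. f)\<rparr>"

definition comp_fctr ::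
    "('u, 'v, 'p, 'q) fctr \<Rightarrow> ('x, 'y, 'u, 'v) fctr \<Rightarrow> ('x, 'y, 'p, 'q) fctr" where
  "comp_fctr G F = \<lparr>OMap = OMap G \<circ> OMap F, AMap = AMap G \<circ> AMap F\<rparr>"

locale cat_functor = C: category C + D: category D
  for C :: "('x, 'y) cat" and D :: "('u, 'v) cat" +
  fixes F :: "('x, 'y, 'u, 'v) fctr"
  assumes OMap_in_Obj: "x \<in> Obj C \<Longrightarrow> OMap F x \<in> Obj D"
    and AMap_in_Hom: "f \<in> Hom C x y \<Longrightarrow> AMap F f \<in> Hom D (OMap F x) (OMap F y)"
    and AMap_Idt: "x \<in> Obj C \<Longrightarrow> AMap F (Idt C x) = Idt D (OMap F x)"
    and AMap_Comp: "f \<in> Hom C x y \<Longrightarrow> g \<in> Hom C y z \<Longrightarrow>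
      AMap F (g \<cdot>\<^bsub>C\<^esub> f) = AMap F g \<cdot>\<^bsub>D\<^esub> AMap F f"

locale nat_trans = F: cat_functor C D F + G: cat_functor C D G
  for C :: "('x, 'y) cat" and D :: "('u, 'v) cat"
    and F :: "('x, 'y, 'u, 'v) fctr" and G :: "('x, 'y, 'u, 'v) fctr" +
  fixes \<tau> :: "'x \<Rightarrow> 'v"
  assumes component_in_Hom: "x \<in> Obj C \<Longrightarrow> \<tau> x \<in> Hom D (OMap F x) (OMap G x)"
    and naturality: "f \<in> Hom C x y \<Longrightarrow> \<tau> y \<cdot>\<^bsub>D\<^esub> AMap F f = AMap G f \<cdot>\<^bsub>D\<^esub> \<tau> x"

locale nat_iso = nat_trans +
  assumes component_iso: "x \<in> Obj C \<Longrightarrow> \<tau> x \<in> Isos D (OMap F x) (OMap G x)"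

definition equivalent_cats :: "('x, 'y) cat \<Rightarrow> ('u, 'v) cat \<Rightarrow> bool" where
  "equivalent_cats C D \<longleftrightarrow>
     (\<exists>F G \<eta> \<epsilon>. cat_functor C D F \<and> cat_functor D C G \<and>
        nat_iso C C id_fctr (comp_fctr G F) \<eta> \<and> nat_iso D D (comp_fctr F G) id_fctr \<epsilon>)"

definition terminal_cat :: "(unit, unit) cat" where
  "terminal_cat = \<lparr>Obj = {()}, Arr = {()}, Dom = (\<lambda>_. ()), Cod = (\<lambda>_. ()), Idt = (\<lambda>_. ()),
     Comp = (\<lambda>_ _. ())\<rparr>"

subsection \<open>Exact categories\<close>

definition null_ideal :: "('o, 'a) cat \<Rightarrow> 'a set \<Rightarrow> bool" where
  "null_ideal C N \<longleftrightarrow> N \<subseteq> Arr C \<and>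
     (\<forall>n \<in> N. (\<forall>a \<in> Arr C. Cod C a = Dom C n \<longrightarrow> n \<cdot>\<^bsub>C\<^esub> a \<in> N) \<and>
              (\<forall>b \<in> Arr C. Dom C b = Cod C n \<longrightarrow> b \<cdot>\<^bsub>C\<^esub> n \<in> N))"

definition is_kernel :: "('o, 'a) cat \<Rightarrow> 'a set \<Rightarrow> 'a \<Rightarrow> 'a \<Rightarrow> bool" where
  "is_kernel C N f k \<longleftrightarrow> f \<in> Arr C \<and> k \<in> Arr C \<and> Cod C k = Dom C f \<and> f \<cdot>\<^bsub>C\<^esub> k \<in> N \<and>
     (\<forall>z \<in> Arr C. Cod C z = Dom C f \<and> f \<cdot>\<^bsub>C\<^esub> z \<in> N \<longrightarrow>
        (\<exists>!u. u \<in> Hom C (Dom C z) (Dom C k) \<and> k \<cdot>\<^bsub>C\<^esub> u = z))"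

definition is_cokernel :: "('o, 'a) cat \<Rightarrow> 'a set \<Rightarrow> 'a \<Rightarrow> 'a \<Rightarrow> bool" where
  "is_cokernel C N f c \<longleftrightarrow> is_kernel (cat_op C) N f c"

definition closed_ideal :: "('o, 'a) cat \<Rightarrow> 'a set \<Rightarrow> bool" where
  "closed_ideal C N \<longleftrightarrow> null_ideal C N \<and>
     (\<forall>n \<in> N. \<exists>E \<in> Obj C. Idt C E \<in> N \<and>
        (\<exists>a \<in> Hom C (Dom C n) E. \<exists>b \<in> Hom C E (Cod C n). n = b \<cdot>\<^bsub>C\<^esub> a))"

definition exact_wrt :: "('o, 'a) cat \<Rightarrow> 'a set \<Rightarrow> bool" where
  "exact_wrt C N \<longleftrightarrow> closed_ideal C N \<and>
     (\<forall>f \<in> Arr C. \<exists>k. is_kernel C N f k) \<and>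
     (\<forall>f \<in> Arr C. \<exists>c. is_cokernel C N f c) \<and>
     (\<forall>f \<in> Arr C. \<exists>e m g h. is_cokernel C N g e \<and> is_kernel C N h m \<and>
        Cod C e = Dom C m \<and> f = m \<cdot>\<^bsub>C\<^esub> e)"

definition Grandis_exact :: "('o, 'a) cat \<Rightarrow> bool" where
  "Grandis_exact C \<longleftrightarrow> category C \<and> (\<exists>N. exact_wrt C N)"

definition zero_object :: "('o, 'a) cat \<Rightarrow> 'o \<Rightarrow> bool" where
  "zero_object C Z \<longleftrightarrow> Z \<in> Obj C \<and>
     (\<forall>A \<in> Obj C. (\<exists>!t. t \<in> Hom C A Z) \<and> (\<exists>!i. i \<in> Hom C Z A))"

definition zero_morphisms :: "('o, 'a) cat \<Rightarrow> 'o \<Rightarrow> 'a set" where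
  "zero_morphisms C Z = {i \<cdot>\<^bsub>C\<^esub> t | A B i t. t \<in> Hom C A Z \<and> i \<in> Hom C Z B}"

definition Puppe_exact :: "('o, 'a) cat \<Rightarrow> bool" where
  "Puppe_exact C \<longleftrightarrow> category C \<and> (\<exists>Z. zero_object C Z \<and> exact_wrt C (zero_morphisms C Z))"

locale preadditive = category C
  for C :: "('o, 'a) cat" (structure) +
  fixes add :: "'a \<Rightarrow> 'a \<Rightarrow> 'a" and nul :: "'o \<Rightarrow> 'o \<Rightarrow> 'a"
  assumes Hom_abelian_group: "A \<in> Obj C \<Longrightarrow> B \<in> Obj C \<Longrightarrow>
      comm_group \<lparr>carrier = Hom C A B, monoid.mult = add, one = nul A B\<rparr>"
    and Comp_add: "f \<in> Hom C A B \<Longrightarrow> g \<in> Hom C A B \<Longrightarrow> h \<in> Hom C B D \<Longrightarrow>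
      h \<cdot> add f g = add (h \<cdot> f) (h \<cdot> g)"
    and add_Comp: "f \<in> Hom C A B \<Longrightarrow> h \<in> Hom C B D \<Longrightarrow> k \<in> Hom C B D \<Longrightarrow>
      add h k \<cdot> f = add (h \<cdot> f) (k \<cdot> f)"

definition has_biproducts :: "('o, 'a) cat \<Rightarrow> ('a \<Rightarrow> 'a \<Rightarrow> 'a) \<Rightarrow> bool" where
  "has_biproducts C add \<longleftrightarrow>
     (\<forall>A \<in> Obj C. \<forall>B \<in> Obj C. \<exists>P \<in> Obj C.
        \<exists>i1 \<in> Hom C A P. \<exists>i2 \<in> Hom C B P. \<exists>p1 \<in> Hom C P A. \<exists>p2 \<in> Hom C P B.
          p1 \<cdot>\<^bsub>C\<^esub> i1 = Idt C A \<and> p2 \<cdot>\<^bsub>C\<^esub> i2 = Idt C B \<and>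
          add (i1 \<cdot>\<^bsub>C\<^esub> p1) (i2 \<cdot>\<^bsub>C\<^esub> p2) = Idt C P)"

definition abelian_category :: "('o, 'a) cat \<Rightarrow> bool" where
  "abelian_category C \<longleftrightarrow>
     (\<exists>add nul Z. preadditive C add nul \<and> zero_object C Z \<and> has_biproducts C add \<and>
        (\<forall>f \<in> Arr C. \<exists>k. is_kernel C (zero_morphisms C Z) f k) \<and>
        (\<forall>f \<in> Arr C. \<exists>c. is_cokernel C (zero_morphisms C Z) f c) \<and>
        (\<forall>m. monic C m \<longrightarrow> (\<exists>f. is_kernel C (zero_morphisms C Z) f m)) \<and>
        (\<forall>e. epic C e \<longrightarrow> (\<exists>f. is_cokernel C (zero_morphisms C Z) f e)))"

section \<open>Strict 2-categories\<close>

record ('o, 'a, 'c) two_cat = "('o, 'a) cat" +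
  Cell :: "'c set"
  Src :: "'c \<Rightarrow> 'a"
  Tgt :: "'c \<Rightarrow> 'a"
  Idt2 :: "'a \<Rightarrow> 'c"
  VComp :: "'c \<Rightarrow> 'c \<Rightarrow> 'c"  (infixr "\<bullet>\<index>" 65)
  HComp :: "'c \<Rightarrow> 'c \<Rightarrow> 'c"  (infixl "\<star>\<index>" 70)

definition vcat :: "('o, 'a, 'c) two_cat \<Rightarrow> ('a, 'c) cat" where
  "vcat L = \<lparr>Obj = Arr L, Arr = Cell L, Dom = Src L, Cod = Tgt L, Idt = Idt2 L, Comp = VComp L\<rparr>"

definition hcat :: "('o, 'a, 'c) two_cat \<Rightarrow> ('o, 'c) cat" where
  "hcat L = \<lparr>Obj = Obj L, Arr = Cell L, Dom = (\<lambda>\<alpha>. Dom L (Src L \<alpha>)), Cod = (\<lambda>\<alpha>. Cod L (Src L \<alpha>)),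
     Idt = (\<lambda>A. Idt2 L (Idt L A)), Comp = HComp L\<rparr>"

abbreviation Cells :: "('o, 'a, 'c) two_cat \<Rightarrow> 'a \<Rightarrow> 'a \<Rightarrow> 'c set" where
  "Cells L \<equiv> Hom (vcat L)"

abbreviation InvCells :: "('o, 'a, 'c) two_cat \<Rightarrow> 'a \<Rightarrow> 'a \<Rightarrow> 'c set" where
  "InvCells L \<equiv> Isos (vcat L)"

abbreviation vinv :: "('o, 'a, 'c) two_cat \<Rightarrow> 'c \<Rightarrow> 'c" where
  "vinv L \<equiv> inverse_of (vcat L)"

locale two_category = category L + V: category "vcat L" + H: category "hcat L"
  for L :: "('o, 'a, 'c) two_cat" (structure) +
  assumes Cells_parallel: "\<alpha> \<in> Cells L f g \<Longrightarrow> Dom L f = Dom L g \<and> Cod L f = Cod L g"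
    and HComp_in_Cells: "f \<in> Hom L A B \<Longrightarrow> g \<in> Hom L B D \<Longrightarrow>
      \<alpha> \<in> Cells L f f' \<Longrightarrow> \<beta> \<in> Cells L g g' \<Longrightarrow> \<beta> \<star> \<alpha> \<in> Cells L (g \<cdot> f) (g' \<cdot> f')"
    and HComp_Idt2: "f \<in> Hom L A B \<Longrightarrow> g \<in> Hom L B D \<Longrightarrow> Idt2 L g \<star> Idt2 L f = Idt2 L (g \<cdot> f)"
    and interchange: "f \<in> Hom L A B \<Longrightarrow> g \<in> Hom L B D \<Longrightarrow>
      \<alpha> \<in> Cells L f f' \<Longrightarrow> \<alpha>' \<in> Cells L f' f'' \<Longrightarrow> \<beta> \<in> Cells L g g' \<Longrightarrow> \<beta>' \<in> Cells L g' g'' \<Longrightarrow>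
      (\<beta>' \<bullet> \<beta>) \<star> (\<alpha>' \<bullet> \<alpha>) = (\<beta>' \<star> \<alpha>') \<bullet> (\<beta> \<star> \<alpha>)"

definition hom_cat :: "('o, 'a, 'c) two_cat \<Rightarrow> 'o \<Rightarrow> 'o \<Rightarrow> ('a, 'c) cat" where
  "hom_cat L A B = \<lparr>Obj = Hom L A B,
     Arr = {\<alpha> \<in> Cell L. Src L \<alpha> \<in> Hom L A B \<and> Tgt L \<alpha> \<in> Hom L A B},
     Dom = Src L, Cod = Tgt L, Idt = Idt2 L, Comp = VComp L\<rparr>"

text \<open>The dual 2-category reverses 1-cells but not 2-cells.\<close>

definition two_op :: "('o, 'a, 'c) two_cat \<Rightarrow> ('o, 'a, 'c) two_cat" where
  "two_op L = \<lparr>Obj = Obj L, Arr = Arr L, Dom = Cod L, Cod = Dom L, Idt = Idt L,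
     Comp = (\<lambda>g f. f \<cdot>\<^bsub>L\<^esub> g),
     Cell = Cell L, Src = Src L, Tgt = Tgt L, Idt2 = Idt2 L, VComp = VComp L,
     HComp = (\<lambda>\<beta> \<alpha>. \<alpha> \<star>\<^bsub>L\<^esub> \<beta>)\<rparr>"

definition two_prod :: "('o, 'a, 'c) two_cat \<Rightarrow> ('p, 'b, 'd) two_cat \<Rightarrow>
    ('o \<times> 'p, 'a \<times> 'b, 'c \<times> 'd) two_cat" where
  "two_prod L M = \<lparr>Obj = Obj L \<times> Obj M, Arr = Arr L \<times> Arr M,
     Dom = map_prod (Dom L) (Dom M), Cod = map_prod (Cod L) (Cod M),
     Idt = map_prod (Idt L) (Idt M),
     Comp = (\<lambda>(g, g') (f, f'). (g \<cdot>\<^bsub>L\<^esub> f, g' \<cdot>\<^bsub>M\<^esub> f')),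
     Cell = Cell L \<times> Cell M, Src = map_prod (Src L) (Src M), Tgt = map_prod (Tgt L) (Tgt M),
     Idt2 = map_prod (Idt2 L) (Idt2 M),
     VComp = (\<lambda>(\<beta>, \<beta>') (\<alpha>, \<alpha>'). (\<beta> \<bullet>\<^bsub>L\<^esub> \<alpha>, \<beta>' \<bullet>\<^bsub>M\<^esub> \<alpha>')),
     HComp = (\<lambda>(\<beta>, \<beta>') (\<alpha>, \<alpha>'). (\<beta> \<star>\<^bsub>L\<^esub> \<alpha>, \<beta>' \<star>\<^bsub>M\<^esub> \<alpha>'))\<rparr>"

text \<open>The 2-cells are the identities, each represented by its underlying 1-cell.\<close>

definition locally_discrete :: "('o, 'a) cat \<Rightarrow> ('o, 'a, 'a) two_cat" where
  "locally_discrete C = \<lparr>Obj = Obj C, Arr = Arr C, Dom = Dom C, Cod = Cod C, Idt = Idt C,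
     Comp = Comp C,
     Cell = Arr C, Src = (\<lambda>f. f), Tgt = (\<lambda>f. f), Idt2 = (\<lambda>f. f), VComp = (\<lambda>g f. f),
     HComp = Comp C\<rparr>"

subsection \<open>Cat-valued pseudofunctors and pseudonatural transformations\<close>

text \<open>
  \<open>PComp F g f x\<close> is the component at \<open>x\<close> of the composition constraint
  \<open>F g \<circ> F f \<Rightarrow> F (g \<cdot> f)\<close>.  Normality means that the unit constraints are identities, so they
  are not part of the data.
\<close>

record ('o, 'a, 'c, 'x, 'y) pfunctor =
  PObj :: "'o \<Rightarrow> ('x, 'y) cat"
  PArr :: "'a \<Rightarrow> ('x, 'y, 'x, 'y) fctr"
  PCell :: "'c \<Rightarrow> 'x \<Rightarrow> 'y"
  PComp :: "'a \<Rightarrow> 'a \<Rightarrow> 'x \<Rightarrow> 'y"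

locale normal_pseudofunctor = two_category X
  for X :: "('o, 'a, 'c) two_cat" (structure) +
  fixes F :: "('o, 'a, 'c, 'x, 'y) pfunctor"
  assumes PObj_category: "A \<in> Obj X \<Longrightarrow> category (PObj F A)"
    and PArr_functor: "f \<in> Hom X A B \<Longrightarrow> cat_functor (PObj F A) (PObj F B) (PArr F f)"
    and PCell_nat_trans: "f \<in> Hom X A B \<Longrightarrow> \<alpha> \<in> Cells X f g \<Longrightarrow>
      nat_trans (PObj F A) (PObj F B) (PArr F f) (PArr F g) (PCell F \<alpha>)"
    and PCell_Idt2: "f \<in> Hom X A B \<Longrightarrow> x \<in> Obj (PObj F A) \<Longrightarrow>
      PCell F (Idt2 X f) x = Idt (PObj F B) (OMap (PArr F f) x)"
    and PCell_VComp: "f \<in> Hom X A B \<Longrightarrow> \<alpha> \<in> Cells X f g \<Longrightarrow> \<beta> \<in> Cells X g h \<Longrightarrow>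
      x \<in> Obj (PObj F A) \<Longrightarrow> PCell F (\<beta> \<bullet> \<alpha>) x = PCell F \<beta> x \<cdot>\<^bsub>PObj F B\<^esub> PCell F \<alpha> x"
    and OMap_PArr_Idt: "A \<in> Obj X \<Longrightarrow> x \<in> Obj (PObj F A) \<Longrightarrow> OMap (PArr F (Idt X A)) x = x"
    and AMap_PArr_Idt: "A \<in> Obj X \<Longrightarrow> y \<in> Arr (PObj F A) \<Longrightarrow> AMap (PArr F (Idt X A)) y = y"
    and PComp_nat_iso: "f \<in> Hom X A B \<Longrightarrow> g \<in> Hom X B D \<Longrightarrow>
      nat_iso (PObj F A) (PObj F D) (comp_fctr (PArr F g) (PArr F f)) (PArr F (g \<cdot> f)) (PComp F g f)"
    and PComp_natural: "f \<in> Hom X A B \<Longrightarrow> g \<in> Hom X B D \<Longrightarrow>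
      \<alpha> \<in> Cells X f f' \<Longrightarrow> \<beta> \<in> Cells X g g' \<Longrightarrow> x \<in> Obj (PObj F A) \<Longrightarrow>
      PComp F g' f' x \<cdot>\<^bsub>PObj F D\<^esub>
          (PCell F \<beta> (OMap (PArr F f') x) \<cdot>\<^bsub>PObj F D\<^esub> AMap (PArr F g) (PCell F \<alpha> x)) =
        PCell F (\<beta> \<star> \<alpha>) x \<cdot>\<^bsub>PObj F D\<^esub> PComp F g f x"
    and PComp_assoc: "f \<in> Hom X A B \<Longrightarrow> g \<in> Hom X B D \<Longrightarrow> h \<in> Hom X D E \<Longrightarrow>
      x \<in> Obj (PObj F A) \<Longrightarrow>
      PComp F (h \<cdot> g) f x \<cdot>\<^bsub>PObj F E\<^esub> PComp F h g (OMap (PArr F f) x) =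
        PComp F h (g \<cdot> f) x \<cdot>\<^bsub>PObj F E\<^esub> AMap (PArr F h) (PComp F g f x)"
    and PComp_Idt_right: "f \<in> Hom X A B \<Longrightarrow> x \<in> Obj (PObj F A) \<Longrightarrow>
      PComp F f (Idt X A) x = Idt (PObj F B) (OMap (PArr F f) x)"
    and PComp_Idt_left: "f \<in> Hom X A B \<Longrightarrow> x \<in> Obj (PObj F A) \<Longrightarrow>
      PComp F (Idt X B) f x = Idt (PObj F B) (OMap (PArr F f) x)"

text \<open>
  \<open>NComp \<nu> A\<close> is the component functor \<open>F A \<rightarrow> G A\<close>, and \<open>NCell \<nu> f x\<close> is the component at \<open>x\<close>
  of the structure isomorphism \<open>G f \<circ> \<nu>\<^sub>A \<Rightarrow> \<nu>\<^sub>B \<circ> F f\<close>.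
\<close>

record ('o, 'a, 'x, 'y, 'u, 'v) pnat =
  NComp :: "'o \<Rightarrow> ('x, 'y, 'u, 'v) fctr"
  NCell :: "'a \<Rightarrow> 'x \<Rightarrow> 'v"

locale pseudonatural =
  F: normal_pseudofunctor X F + G: normal_pseudofunctor X G
  for X :: "('o, 'a, 'c) two_cat" (structure)
    and F :: "('o, 'a, 'c, 'x, 'y) pfunctor" and G :: "('o, 'a, 'c, 'u, 'v) pfunctor" +
  fixes \<nu> :: "('o, 'a, 'x, 'y, 'u, 'v) pnat"
  assumes NComp_functor: "A \<in> Obj X \<Longrightarrow> cat_functor (PObj F A) (PObj G A) (NComp \<nu> A)"
    and NCell_nat_iso: "f \<in> Hom X A B \<Longrightarrow>
      nat_iso (PObj F A) (PObj G B)
        (comp_fctr (PArr G f) (NComp \<nu> A)) (comp_fctr (NComp \<nu> B) (PArr F f)) (NCell \<nu> f)"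
    and NCell_natural: "f \<in> Hom X A B \<Longrightarrow> \<alpha> \<in> Cells X f g \<Longrightarrow> x \<in> Obj (PObj F A) \<Longrightarrow>
      NCell \<nu> g x \<cdot>\<^bsub>PObj G B\<^esub> PCell G \<alpha> (OMap (NComp \<nu> A) x) =
        AMap (NComp \<nu> B) (PCell F \<alpha> x) \<cdot>\<^bsub>PObj G B\<^esub> NCell \<nu> f x"
    and NCell_Comp: "f \<in> Hom X A B \<Longrightarrow> g \<in> Hom X B D \<Longrightarrow> x \<in> Obj (PObj F A) \<Longrightarrow>
      NCell \<nu> (g \<cdot> f) x \<cdot>\<^bsub>PObj G D\<^esub> PComp G g f (OMap (NComp \<nu> A) x) =
        AMap (NComp \<nu> D) (PComp F g f x) \<cdot>\<^bsub>PObj G D\<^esub>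
          (NCell \<nu> g (OMap (PArr F f) x) \<cdot>\<^bsub>PObj G D\<^esub> AMap (PArr G g) (NCell \<nu> f x))"
    and NCell_Idt: "A \<in> Obj X \<Longrightarrow> x \<in> Obj (PObj F A) \<Longrightarrow>
      NCell \<nu> (Idt X A) x = Idt (PObj G A) (OMap (NComp \<nu> A) x)"

text \<open>
  The strict 2-functor \<open>Hom(-,-)\<close> on \<open>L\<^sup>o\<^sup>p \<times> L\<close>; a 1-cell of \<open>L\<^sup>o\<^sup>p \<times> L\<close> from \<open>(A, B)\<close> to
  \<open>(A', B')\<close> is a pair of \<open>a : A' \<rightarrow> A\<close> and \<open>b : B \<rightarrow> B'\<close> in \<open>L\<close>.
\<close>

definition hom_pfunctor ::
    "('o, 'a, 'c) two_cat \<Rightarrow> ('o \<times> 'o, 'a \<times> 'a, 'c \<times> 'c, 'a, 'c) pfunctor" where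
  "hom_pfunctor L = \<lparr>
     PObj = (\<lambda>(A, B). hom_cat L A B),
     PArr = (\<lambda>(a, b). \<lparr>OMap = (\<lambda>n. b \<cdot>\<^bsub>L\<^esub> n \<cdot>\<^bsub>L\<^esub> a),
                        AMap = (\<lambda>\<mu>. Idt2 L b \<star>\<^bsub>L\<^esub> \<mu> \<star>\<^bsub>L\<^esub> Idt2 L a)\<rparr>),
     PCell = (\<lambda>(\<alpha>, \<beta>) n. \<beta> \<star>\<^bsub>L\<^esub> Idt2 L n \<star>\<^bsub>L\<^esub> \<alpha>),
     PComp = (\<lambda>(a', b') (a, b) n. Idt2 L (b' \<cdot>\<^bsub>L\<^esub> b \<cdot>\<^bsub>L\<^esub> n \<cdot>\<^bsub>L\<^esub> (a \<cdot>\<^bsub>L\<^esub> a')))\<rparr>"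

section \<open>2-ideals\<close>

record ('o, 'a, 'c, 'x, 'y) two_ideal_data =
  NPf :: "('o \<times> 'o, 'a \<times> 'a, 'c \<times> 'c, 'x, 'y) pfunctor"
  NNu :: "('o \<times> 'o, 'a \<times> 'a, 'x, 'y, 'a, 'c) pnat"

text \<open>
  \<open>null_mor I A B n\<close> and \<open>null_2cell I A B m\<close> are the 1-cell and the 2-cell of the ambient
  2-category that an object \<open>n\<close> and an arrow \<open>m\<close> of \<open>N(A, B)\<close> stand for; \<open>restr I a b n\<close> is
  \<open>N(a, b)(n)\<close>, and \<open>nu I a b n\<close> is the 2-cell from \<open>b n a\<close> to it.
\<close>

definition null_cat :: "('o, 'a, 'c, 'x, 'y) two_ideal_data \<Rightarrow> 'o \<Rightarrow> 'o \<Rightarrow> ('x, 'y) cat" where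
  "null_cat I A B = PObj (NPf I) (A, B)"

definition null_mor :: "('o, 'a, 'c, 'x, 'y) two_ideal_data \<Rightarrow> 'o \<Rightarrow> 'o \<Rightarrow> 'x \<Rightarrow> 'a" where
  "null_mor I A B n = OMap (NComp (NNu I) (A, B)) n"

definition null_2cell :: "('o, 'a, 'c, 'x, 'y) two_ideal_data \<Rightarrow> 'o \<Rightarrow> 'o \<Rightarrow> 'y \<Rightarrow> 'c" where
  "null_2cell I A B m = AMap (NComp (NNu I) (A, B)) m"

definition restr :: "('o, 'a, 'c, 'x, 'y) two_ideal_data \<Rightarrow> 'a \<Rightarrow> 'a \<Rightarrow> 'x \<Rightarrow> 'x" where
  "restr I a b n = OMap (PArr (NPf I) (a, b)) n"

definition nu :: "('o, 'a, 'c, 'x, 'y) two_ideal_data \<Rightarrow> 'a \<Rightarrow> 'a \<Rightarrow> 'x \<Rightarrow> 'c" where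
  "nu I a b n = NCell (NNu I) (a, b) n"

definition two_ideal ::
    "('o, 'a, 'c) two_cat \<Rightarrow> ('o, 'a, 'c, 'x, 'y) two_ideal_data \<Rightarrow> bool" where
  "two_ideal L I \<longleftrightarrow> two_category L \<and>
     normal_pseudofunctor (two_prod (two_op L) L) (NPf I) \<and>
     pseudonatural (two_prod (two_op L) L) (NPf I) (hom_pfunctor L) (NNu I) \<and>
     (\<forall>A \<in> Obj L. \<forall>B \<in> Obj L.
        inj_on (null_mor I A B) (Obj (null_cat I A B)) \<and>
        (\<forall>n \<in> Obj (null_cat I A B). \<forall>n' \<in> Obj (null_cat I A B).
           inj_on (null_2cell I A B) (Hom (null_cat I A B) n n')))"

text \<open>The 2-ideal \<open>I\<close> regarded as a 2-ideal in the dual 2-category.\<close>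

definition ideal_op ::
    "('o, 'a, 'c, 'x, 'y) two_ideal_data \<Rightarrow> ('o, 'a, 'c, 'x, 'y) two_ideal_data" where
  "ideal_op I = \<lparr>
     NPf = \<lparr>PObj = (\<lambda>(A, B). PObj (NPf I) (B, A)),
            PArr = (\<lambda>(a, b). PArr (NPf I) (b, a)),
            PCell = (\<lambda>(\<alpha>, \<beta>). PCell (NPf I) (\<beta>, \<alpha>)),
            PComp = (\<lambda>(a', b') (a, b). PComp (NPf I) (b', a') (b, a))\<rparr>,
     NNu = \<lparr>NComp = (\<lambda>(A, B). NComp (NNu I) (B, A)),
            NCell = (\<lambda>(a, b). NCell (NNu I) (b, a))\<rparr>\<rparr>"

text \<open>
  \<open>is_null_2cell I A B n n' \<theta>\<close>: the 2-cell \<open>\<theta>\<close> between the null morphisms \<open>n\<close> and \<open>n'\<close> is null;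
  \<open>is_null_iso\<close>: it is an isomorphism of \<open>N(A, B)\<close>.
\<close>

definition is_null_2cell ::
    "('o, 'a, 'c, 'x, 'y) two_ideal_data \<Rightarrow> 'o \<Rightarrow> 'o \<Rightarrow> 'x \<Rightarrow> 'x \<Rightarrow> 'c \<Rightarrow> bool" where
  "is_null_2cell I A B n n' \<theta> \<longleftrightarrow> (\<exists>m \<in> Hom (null_cat I A B) n n'. null_2cell I A B m = \<theta>)"

definition is_null_iso ::
    "('o, 'a, 'c, 'x, 'y) two_ideal_data \<Rightarrow> 'o \<Rightarrow> 'o \<Rightarrow> 'x \<Rightarrow> 'x \<Rightarrow> 'c \<Rightarrow> bool" where
  "is_null_iso I A B n n' \<theta> \<longleftrightarrow> (\<exists>m \<in> Isos (null_cat I A B) n n'. null_2cell I A B m = \<theta>)"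

subsection \<open>2-kernels, 2-cokernels and closed 2-ideals\<close>

definition two_kernel :: "('o, 'a, 'c) two_cat \<Rightarrow> ('o, 'a, 'c, 'x, 'y) two_ideal_data \<Rightarrow>
    'a \<Rightarrow> 'a \<Rightarrow> 'x \<Rightarrow> 'c \<Rightarrow> bool" where
  "two_kernel L I f k n \<alpha> \<longleftrightarrow>
     (\<exists>K A B. f \<in> Hom L A B \<and> k \<in> Hom L K A \<and> n \<in> Obj (null_cat I K B) \<and>
        \<alpha> \<in> InvCells L (f \<cdot>\<^bsub>L\<^esub> k) (null_mor I K B n) \<and>
        (\<forall>Z z p \<beta>. z \<in> Hom L Z A \<and> p \<in> Obj (null_cat I Z B) \<and>
             \<beta> \<in> InvCells L (f \<cdot>\<^bsub>L\<^esub> z) (null_mor I Z B p) \<longrightarrow>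
           (\<exists>u \<in> Hom L Z K. \<exists>\<gamma> \<in> InvCells L z (k \<cdot>\<^bsub>L\<^esub> u).
              is_null_iso I Z B p (restr I u (Idt L B) n)
                (nu I u (Idt L B) n \<bullet>\<^bsub>L\<^esub> (\<alpha> \<star>\<^bsub>L\<^esub> Idt2 L u) \<bullet>\<^bsub>L\<^esub> (Idt2 L f \<star>\<^bsub>L\<^esub> \<gamma>) \<bullet>\<^bsub>L\<^esub> vinv L \<beta>))) \<and>
        (\<forall>Z u v l. u \<in> Hom L Z K \<and> v \<in> Hom L Z K \<and> l \<in> Cells L (k \<cdot>\<^bsub>L\<^esub> u) (k \<cdot>\<^bsub>L\<^esub> v) \<and>
             is_null_2cell I Z B (restr I u (Idt L B) n) (restr I v (Idt L B) n)
               (nu I v (Idt L B) n \<bullet>\<^bsub>L\<^esub> (\<alpha> \<star>\<^bsub>L\<^esub> Idt2 L v) \<bullet>\<^bsub>L\<^esub> (Idt2 L f \<star>\<^bsub>L\<^esub> l) \<bullet>\<^bsub>L\<^esub>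
                (vinv L \<alpha> \<star>\<^bsub>L\<^esub> Idt2 L u) \<bullet>\<^bsub>L\<^esub> vinv L (nu I u (Idt L B) n)) \<longrightarrow>
           (\<exists>!\<mu>. \<mu> \<in> Cells L u v \<and> Idt2 L k \<star>\<^bsub>L\<^esub> \<mu> = l)))"

definition two_cokernel :: "('o, 'a, 'c) two_cat \<Rightarrow> ('o, 'a, 'c, 'x, 'y) two_ideal_data \<Rightarrow>
    'a \<Rightarrow> 'a \<Rightarrow> 'x \<Rightarrow> 'c \<Rightarrow> bool" where
  "two_cokernel L I f c n \<alpha> \<longleftrightarrow> two_kernel (two_op L) (ideal_op I) f c n \<alpha>"

definition reflects_null_morphisms ::
    "('o, 'a, 'c) two_cat \<Rightarrow> ('o, 'a, 'c, 'x, 'y) two_ideal_data \<Rightarrow> 'a \<Rightarrow> bool" where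
  "reflects_null_morphisms L I k \<longleftrightarrow>
     (\<exists>K A. k \<in> Hom L K A \<and>
        (\<forall>D s n \<delta>. s \<in> Hom L D K \<and> n \<in> Obj (null_cat I D A) \<and>
             \<delta> \<in> InvCells L (k \<cdot>\<^bsub>L\<^esub> s) (null_mor I D A n) \<longrightarrow>
           (\<exists>s' \<in> Obj (null_cat I D K). \<exists>\<psi> \<in> InvCells L s (null_mor I D K s').
              is_null_iso I D A n (restr I (Idt L D) k s')
                (nu I (Idt L D) k s' \<bullet>\<^bsub>L\<^esub> (Idt2 L k \<star>\<^bsub>L\<^esub> \<psi>) \<bullet>\<^bsub>L\<^esub> vinv L \<delta>))))"

definition reflects_null_2cells ::
    "('o, 'a, 'c) two_cat \<Rightarrow> ('o, 'a, 'c, 'x, 'y) two_ideal_data \<Rightarrow> 'a \<Rightarrow> bool" where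
  "reflects_null_2cells L I k \<longleftrightarrow>
     (\<exists>K A. k \<in> Hom L K A \<and>
        (\<forall>D s s' \<mu>. D \<in> Obj L \<and> s \<in> Obj (null_cat I D K) \<and> s' \<in> Obj (null_cat I D K) \<and>
             \<mu> \<in> Cells L (null_mor I D K s) (null_mor I D K s') \<and>
             is_null_2cell I D A (restr I (Idt L D) k s) (restr I (Idt L D) k s')
               (nu I (Idt L D) k s' \<bullet>\<^bsub>L\<^esub> (Idt2 L k \<star>\<^bsub>L\<^esub> \<mu>) \<bullet>\<^bsub>L\<^esub> vinv L (nu I (Idt L D) k s)) \<longrightarrow>
           is_null_2cell I D K s s' \<mu>))"

definition kernels_reflect ::
    "('o, 'a, 'c) two_cat \<Rightarrow> ('o, 'a, 'c, 'x, 'y) two_ideal_data \<Rightarrow> bool" where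
  "kernels_reflect L I \<longleftrightarrow>
     (\<forall>f k n \<alpha>. two_kernel L I f k n \<alpha> \<longrightarrow>
        reflects_null_morphisms L I k \<and> reflects_null_2cells L I k)"

definition closed_two_ideal ::
    "('o, 'a, 'c) two_cat \<Rightarrow> ('o, 'a, 'c, 'x, 'y) two_ideal_data \<Rightarrow> bool" where
  "closed_two_ideal L I \<longleftrightarrow> two_ideal L I \<and>
     kernels_reflect L I \<and> kernels_reflect (two_op L) (ideal_op I)"

section \<open>2-exactness\<close>

definition kernels_exist ::
    "('o, 'a, 'c) two_cat \<Rightarrow> ('o, 'a, 'c, 'x, 'y) two_ideal_data \<Rightarrow> bool" where
  "kernels_exist L I \<longleftrightarrow> (\<forall>f \<in> Arr L. \<exists>k n \<alpha>. two_kernel L I f k n \<alpha>)"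

text \<open>
  Every 2-kernel \<open>m\<close> is a 2-kernel of each of its 2-cokernels \<open>c\<close>; the structure 2-cell
  \<open>\<alpha>' : c m \<Rightarrow> n'\<close> of \<open>m\<close> agrees with the structure 2-cell \<open>\<alpha> : c m \<Rightarrow> n\<close> of \<open>c\<close> up to an
  invertible null 2-cell \<open>n \<Rightarrow> n'\<close>.
\<close>

definition kernels_normal ::
    "('o, 'a, 'c) two_cat \<Rightarrow> ('o, 'a, 'c, 'x, 'y) two_ideal_data \<Rightarrow> bool" where
  "kernels_normal L I \<longleftrightarrow>
     (\<forall>f m q \<phi> c n \<alpha>. two_kernel L I f m q \<phi> \<and> two_cokernel L I m c n \<alpha> \<longrightarrow>
        (\<exists>n' \<alpha>'. two_kernel L I c m n' \<alpha>' \<and>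
           is_null_iso I (Dom L m) (Cod L c) n n' (\<alpha>' \<bullet>\<^bsub>L\<^esub> vinv L \<alpha>)))"

definition two_exact_wrt ::
    "('o, 'a, 'c) two_cat \<Rightarrow> ('o, 'a, 'c, 'x, 'y) two_ideal_data \<Rightarrow> bool" where
  "two_exact_wrt L I \<longleftrightarrow> closed_two_ideal L I \<and>
     kernels_exist L I \<and> kernels_exist (two_op L) (ideal_op I) \<and>
     kernels_normal L I \<and> kernels_normal (two_op L) (ideal_op I) \<and>
     (\<forall>f \<in> Arr L. \<exists>g e n \<alpha> h m n' \<alpha>'.
        two_cokernel L I g e n \<alpha> \<and> two_kernel L I h m n' \<alpha>' \<and>
        Cod L e = Dom L m \<and> InvCells L f (m \<cdot>\<^bsub>L\<^esub> e) \<noteq> {})"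

text \<open>
  Letting the categories \<open>N(A, B)\<close> have 1-cells as objects and 2-cells as arrows loses no
  generality: the components of \<open>\<nu>\<close> are injective on objects and faithful, so every 2-ideal can be
  transported along them to one whose \<open>N(A, B)\<close> are subcategories of the hom-categories.
\<close>

definition Grandis_2_exact :: "('o, 'a, 'c) two_cat \<Rightarrow> bool" where
  "Grandis_2_exact L \<longleftrightarrow> two_category L \<and>
     (\<exists>I :: ('o, 'a, 'c, 'a, 'c) two_ideal_data. two_exact_wrt L I)"

definition bizero :: "('o, 'a, 'c) two_cat \<Rightarrow> 'o \<Rightarrow> bool" where
  "bizero L Z \<longleftrightarrow> Z \<in> Obj L \<and>
     (\<forall>A \<in> Obj L. equivalent_cats (hom_cat L A Z) terminal_cat \<and>
                  equivalent_cats (hom_cat L Z A) terminal_cat)"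

text \<open>
  When \<open>Z\<close> is a bizero object, the 2-cells \<open>\<theta>\<close> and \<open>\<iota>\<close> below are the unique ones with their
  sources and targets.
\<close>

definition zero_null_cat :: "('o, 'a, 'c) two_cat \<Rightarrow> 'o \<Rightarrow> 'o \<Rightarrow> 'o \<Rightarrow> ('a, 'c) cat" where
  "zero_null_cat L Z A B = \<lparr>
     Obj = {i \<cdot>\<^bsub>L\<^esub> t | i t. t \<in> Hom L A Z \<and> i \<in> Hom L Z B},
     Arr = {\<iota> \<star>\<^bsub>L\<^esub> \<theta> | \<iota> \<theta> t t' i i'. t \<in> Hom L A Z \<and> t' \<in> Hom L A Z \<and> \<theta> \<in> Cells L t t' \<and>
              i \<in> Hom L Z B \<and> i' \<in> Hom L Z B \<and> \<iota> \<in> Cells L i i'},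
     Dom = Src L, Cod = Tgt L, Idt = Idt2 L, Comp = VComp L\<rparr>"

definition zero_two_ideal ::
    "('o, 'a, 'c) two_cat \<Rightarrow> 'o \<Rightarrow> ('o, 'a, 'c, 'a, 'c) two_ideal_data" where
  "zero_two_ideal L Z = \<lparr>
     NPf = (hom_pfunctor L)\<lparr>PObj := (\<lambda>(A, B). zero_null_cat L Z A B)\<rparr>,
     NNu = \<lparr>NComp = (\<lambda>_. id_fctr), NCell = (\<lambda>(a, b) n. Idt2 L (b \<cdot>\<^bsub>L\<^esub> n \<cdot>\<^bsub>L\<^esub> a))\<rparr>\<rparr>"

definition Puppe_2_exact :: "('o, 'a, 'c) two_cat \<Rightarrow> bool" where
  "Puppe_2_exact L \<longleftrightarrow> two_category L \<and>
     (\<exists>Z. bizero L Z \<and> two_exact_wrt L (zero_two_ideal L Z))"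

end

theory Submission
  imports Defs
begin

text \<open>
  In a locally discrete 2-category every condition on 2-cells degenerates to an equation between
  1-cells, so 2-kernels are ordinary kernels and the 2-dimensional axioms follow from the
  1-dimensional ones.  Kernels reflect null morphisms because a null \<open>k s\<close> factors as \<open>b a\<close> through an
  object with null identity: then \<open>b\<close> is killed by whatever \<open>k\<close> is a kernel of, so \<open>b\<close> factors
  through \<open>k\<close> by some \<open>u\<close> and \<open>s = u a\<close>.

  For an abelian category, write \<open>f = m e\<close> with \<open>m\<close> a kernel of the cokernel \<open>c\<close> of \<open>f\<close>.  If
  \<open>x e = 0\<close> and \<open>k\<close> is a kernel of \<open>x\<close>, the monomorphism \<open>m k\<close> is a kernel of some \<open>h\<close>; since
  \<open>f\<close> factors through \<open>m k\<close>, \<open>h\<close> factors through \<open>c\<close>, hence \<open>h m = 0\<close>, so \<open>k\<close> is split epic and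
  \<open>x = 0\<close>.  Thus \<open>e\<close> is epic, hence a cokernel.
\<close>

section \<open>Duals and products of categories\<close>

lemma cat_op_simps [simp]:
  "Obj (cat_op C) = Obj C" "Arr (cat_op C) = Arr C" "Dom (cat_op C) = Cod C"
  "Cod (cat_op C) = Dom C" "Idt (cat_op C) = Idt C" "g \<cdot>\<^bsub>cat_op C\<^esub> f = f \<cdot>\<^bsub>C\<^esub> g"
  by (simp_all add: cat_op_def)

lemma Hom_cat_op [simp]: "Hom (cat_op C) A B = Hom C B A"
  by (auto simp: Hom_def)

lemma category_cat_op:
  fixes C :: "('o, 'a) cat"
  assumes "category C"
  shows "category (cat_op C)"
proof -
  interpret category C by fact
  show ?thesis
    by unfold_locales
      (auto intro: Dom_in_Obj Cod_in_Obj Idt_in_Hom Comp_in_Hom Comp_Idt Idt_Comp Comp_assoc[symmetric])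
qed

text \<open>A 2-ideal lives on the product of the dual 2-category with the 2-category. For locally
  discrete factors this product is again locally discrete, on the present category; see
  \<open>two_prod_locally_discrete\<close>.\<close>

definition cat_prod :: "('o, 'a) cat \<Rightarrow> ('p, 'b) cat \<Rightarrow> ('o \<times> 'p, 'a \<times> 'b) cat" where
  "cat_prod C D = \<lparr>Obj = Obj C \<times> Obj D, Arr = Arr C \<times> Arr D,
     Dom = map_prod (Dom C) (Dom D), Cod = map_prod (Cod C) (Cod D),
     Idt = map_prod (Idt C) (Idt D),
     Comp = (\<lambda>(g, g') (f, f'). (g \<cdot>\<^bsub>C\<^esub> f, g' \<cdot>\<^bsub>D\<^esub> f'))\<rparr>"

lemma cat_prod_simps [simp]:
  "Obj (cat_prod C D) = Obj C \<times> Obj D" "Arr (cat_prod C D) = Arr C \<times> Arr D"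
  "Dom (cat_prod C D) = map_prod (Dom C) (Dom D)" "Cod (cat_prod C D) = map_prod (Cod C) (Cod D)"
  "Idt (cat_prod C D) = map_prod (Idt C) (Idt D)"
  "(g, g') \<cdot>\<^bsub>cat_prod C D\<^esub> (f, f') = (g \<cdot>\<^bsub>C\<^esub> f, g' \<cdot>\<^bsub>D\<^esub> f')"
  by (simp_all add: cat_prod_def)

lemma Hom_cat_prod [simp]: "Hom (cat_prod C D) (A, A') (B, B') = Hom C A B \<times> Hom D A' B'"
  by (auto simp: Hom_def)

lemma category_cat_prod:
  assumes "category C" "category D"
  shows "category (cat_prod C D)"
proof -
  interpret C: category C by fact
  interpret D: category D by fact
  show ?thesis
  proof
    fix f assume "f \<in> Arr (cat_prod C D)"
    then show "Dom (cat_prod C D) f \<in> Obj (cat_prod C D)" "Cod (cat_prod C D) f \<in> Obj (cat_prod C D)"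
      by (auto simp: C.Dom_in_Obj D.Dom_in_Obj C.Cod_in_Obj D.Cod_in_Obj)
  next
    fix A assume "A \<in> Obj (cat_prod C D)"
    then show "Idt (cat_prod C D) A \<in> Hom (cat_prod C D) A A"
      by (cases A) (auto intro: C.Idt_in_Hom D.Idt_in_Hom)
  next
    fix f g A B E assume "f \<in> Hom (cat_prod C D) A B" "g \<in> Hom (cat_prod C D) B E"
    then show "g \<cdot>\<^bsub>cat_prod C D\<^esub> f \<in> Hom (cat_prod C D) A E"
      by (cases A; cases B; cases E)
        (auto intro: C.Comp_in_Hom D.Comp_in_Hom)
  next
    fix f A B assume "f \<in> Hom (cat_prod C D) A B"
    then show "f \<cdot>\<^bsub>cat_prod C D\<^esub> Idt (cat_prod C D) A = f" "Idt (cat_prod C D) B \<cdot>\<^bsub>cat_prod C D\<^esub> f = f"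
      by (cases A; cases B; auto simp: C.Comp_Idt D.Comp_Idt C.Idt_Comp D.Idt_Comp)+
  next
    fix f g h A B E G
    assume "f \<in> Hom (cat_prod C D) A B" "g \<in> Hom (cat_prod C D) B E" "h \<in> Hom (cat_prod C D) E G"
    then show "h \<cdot>\<^bsub>cat_prod C D\<^esub> g \<cdot>\<^bsub>cat_prod C D\<^esub> f = h \<cdot>\<^bsub>cat_prod C D\<^esub> (g \<cdot>\<^bsub>cat_prod C D\<^esub> f)"
      by (cases A; cases B; cases E; cases G)
        (auto simp: C.Comp_assoc D.Comp_assoc)
  qed
qed

section \<open>Discrete categories\<close>

text \<open>Each element serves as object and as its own identity. Composition returns its right
  argument without a test, which is sound since composable arrows are equal; it copies
  \<open>VComp\<close> of \<open>locally_discrete\<close>, so vertical and hom-categories there are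
  literally equal to categories of this form.\<close>

definition discrete_cat :: "'a set \<Rightarrow> ('a, 'a) cat" where
  "discrete_cat S = \<lparr>Obj = S, Arr = S, Dom = (\<lambda>f. f), Cod = (\<lambda>f. f), Idt = (\<lambda>f. f),
     Comp = (\<lambda>g f. f)\<rparr>"

lemma discrete_cat_simps [simp]:
  "Obj (discrete_cat S) = S" "Arr (discrete_cat S) = S" "Dom (discrete_cat S) x = x"
  "Cod (discrete_cat S) x = x" "Idt (discrete_cat S) x = x" "g \<cdot>\<^bsub>discrete_cat S\<^esub> f = f"
  by (simp_all add: discrete_cat_def)

lemma Hom_discrete_cat [simp]: "f \<in> Hom (discrete_cat S) x y \<longleftrightarrow> f \<in> S \<and> x = f \<and> y = f"
  by (auto simp: Hom_def)

lemma Isos_discrete_cat [simp]: "f \<in> Isos (discrete_cat S) x y \<longleftrightarrow> f \<in> S \<and> x = f \<and> y = f"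
  by (auto simp: Isos_def)

lemma inverse_of_discrete_cat [simp]: "f \<in> S \<Longrightarrow> inverse_of (discrete_cat S) f = f"
  unfolding inverse_of_def by (rule the_equality) (simp, metis Hom_discrete_cat discrete_cat_simps(4))

lemma category_discrete_cat: "category (discrete_cat S)"
  by unfold_locales auto

lemma cat_functor_discrete:
  assumes "\<And>x. x \<in> S \<Longrightarrow> OMap F x \<in> T" "\<And>x. x \<in> S \<Longrightarrow> AMap F x = OMap F x"
  shows "cat_functor (discrete_cat S) (discrete_cat T) F"
  by (intro cat_functor.intro cat_functor_axioms.intro category_discrete_cat) (use assms in auto)

text \<open>A component in a discrete target is an identity, so two functors are related only if
  they agree, and the components are then their common values. Agreement is asked on
  \<open>S\<close> alone, as the maps are arbitrary elsewhere.\<close>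

lemma nat_iso_discrete:
  assumes "cat_functor (discrete_cat S) (discrete_cat T) F"
    and "\<And>x. x \<in> S \<Longrightarrow> OMap G x = OMap F x" "\<And>x. x \<in> S \<Longrightarrow> AMap G x = OMap F x"
    and "\<And>x. x \<in> S \<Longrightarrow> \<tau> x = OMap F x"
  shows "nat_iso (discrete_cat S) (discrete_cat T) F G \<tau>"
proof -
  interpret F: cat_functor "discrete_cat S" "discrete_cat T" F by fact
  have F: "OMap F x \<in> T" "AMap F x = OMap F x" if "x \<in> S" for x
    using F.OMap_in_Obj[of x] F.AMap_in_Hom[of x x x] that by auto
  have "cat_functor (discrete_cat S) (discrete_cat T) G"
    by (rule cat_functor_discrete) (use assms F in auto)
  then show ?thesis
    by (intro nat_iso.intro nat_trans.intro nat_trans_axioms.intro nat_iso_axioms.intro assms(1))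
      (use assms F in auto)
qed

text \<open>This will be applied to the hom-sets into and out of a zero object.\<close>

lemma equivalent_discrete_terminal: "equivalent_cats (discrete_cat {t}) terminal_cat"
proof -
  have T: "category terminal_cat"
    by unfold_locales (auto simp: terminal_cat_def Hom_def)
  let ?F = "\<lparr>OMap = \<lambda>_. (), AMap = \<lambda>_. ()\<rparr>"
  let ?G = "\<lparr>OMap = \<lambda>_. t, AMap = \<lambda>_. t\<rparr>"
  have F: "cat_functor (discrete_cat {t}) terminal_cat ?F"
    by (intro cat_functor.intro category_discrete_cat T cat_functor_axioms.intro)
      (auto simp: terminal_cat_def Hom_def)
  have G: "cat_functor terminal_cat (discrete_cat {t}) ?G"
    by (intro cat_functor.intro category_discrete_cat T cat_functor_axioms.intro)
      (auto simp: terminal_cat_def)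
  have I: "cat_functor (discrete_cat {t}) (discrete_cat {t}) id_fctr"
    by (rule cat_functor_discrete) (auto simp: id_fctr_def)
  have eta: "nat_iso (discrete_cat {t}) (discrete_cat {t}) id_fctr (comp_fctr ?G ?F) (\<lambda>x. x)"
    by (rule nat_iso_discrete[OF I]) (auto simp: id_fctr_def comp_fctr_def)
  have "nat_iso terminal_cat terminal_cat (comp_fctr ?F ?G) id_fctr (\<lambda>x. x)"
    by (intro nat_iso.intro nat_trans.intro cat_functor.intro T cat_functor_axioms.intro
        nat_trans_axioms.intro nat_iso_axioms.intro)
      (auto simp: terminal_cat_def Hom_def Isos_def)
  with F G eta show ?thesis
    unfolding equivalent_cats_def by blast
qed

section \<open>Locally discrete 2-categories\<close>

lemma locally_discrete_simps [simp]:
  "Obj (locally_discrete C) = Obj C" "Arr (locally_discrete C) = Arr C"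
  "Dom (locally_discrete C) = Dom C" "Cod (locally_discrete C) = Cod C"
  "Idt (locally_discrete C) = Idt C" "Comp (locally_discrete C) = Comp C"
  "Cell (locally_discrete C) = Arr C" "Src (locally_discrete C) = (\<lambda>f. f)"
  "Tgt (locally_discrete C) = (\<lambda>f. f)" "Idt2 (locally_discrete C) = (\<lambda>f. f)"
  "VComp (locally_discrete C) = (\<lambda>g f. f)" "HComp (locally_discrete C) = Comp C"
  by (simp_all add: locally_discrete_def)

lemma Hom_locally_discrete [simp]: "Hom (locally_discrete C) = Hom C"
  by (simp add: Hom_def fun_eq_iff)

lemma vcat_locally_discrete [simp]: "vcat (locally_discrete C) = discrete_cat (Arr C)"
  by (simp add: vcat_def discrete_cat_def)

lemma hcat_locally_discrete [simp]: "hcat (locally_discrete C) = C"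
  by (simp add: hcat_def)

lemma hom_cat_locally_discrete [simp]:
  "hom_cat (locally_discrete C) A B = discrete_cat (Hom C A B)"
  by (auto simp: hom_cat_def discrete_cat_def Hom_def)

text \<open>Through this equation every statement about 2-cokernels becomes one about 2-kernels over
  \<open>cat_op C\<close>.\<close>

lemma two_op_locally_discrete [simp]:
  "two_op (locally_discrete C) = locally_discrete (cat_op C)"
  by (simp add: two_op_def locally_discrete_def cat_op_def)

lemma two_prod_locally_discrete [simp]:
  "two_prod (locally_discrete C) (locally_discrete D) = locally_discrete (cat_prod C D)"
  by (auto simp: two_prod_def locally_discrete_def cat_prod_def fun_eq_iff)

lemma two_category_locally_discrete:
  fixes C :: "('o, 'a) cat"
  assumes "category C"
  shows "two_category (locally_discrete C)"
proof -
  interpret category C by fact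
  have "category (locally_discrete C)"
    by unfold_locales
      (auto intro: Dom_in_Obj Cod_in_Obj Idt_in_Hom Comp_in_Hom Comp_Idt Idt_Comp Comp_assoc)
  \<comment> \<open>A horizontal composite of 2-cells is a composite of arrows, and
    \<open>HComp_in_Cells\<close> requires it to be a cell again.\<close>
  moreover have "g \<cdot>\<^bsub>C\<^esub> f \<in> Arr C" if "f \<in> Hom C A B" "g \<in> Hom C B D" for f g A B D
    using Comp_in_Hom[OF that] by (simp add: Hom_def)
  ultimately show ?thesis
    by (intro two_category.intro two_category_axioms.intro)
      (auto simp: category_discrete_cat assms)
qed

section \<open>Pseudofunctors with discrete values\<close>

text \<open>With discrete values \<open>S A\<close>, all constraints are identities and all
  coherence laws compare identities. What remains is a strictly functorial action on elements; the
  other components must repeat its values on well-typed arguments.\<close>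

lemma normal_pseudofunctor_locally_discrete:
  assumes P: "category P"
    and obj: "\<And>A. A \<in> Obj P \<Longrightarrow> PObj F A = discrete_cat (S A)"
    and arr: "\<And>f A B x. f \<in> Hom P A B \<Longrightarrow> x \<in> S A \<Longrightarrow> OMap (PArr F f) x \<in> S B"
    and AMap: "\<And>f A B x. f \<in> Hom P A B \<Longrightarrow> x \<in> S A \<Longrightarrow> AMap (PArr F f) x = OMap (PArr F f) x"
    and cell: "\<And>f A B x. f \<in> Hom P A B \<Longrightarrow> x \<in> S A \<Longrightarrow> PCell F f x = OMap (PArr F f) x"
    and idt: "\<And>A x. A \<in> Obj P \<Longrightarrow> x \<in> S A \<Longrightarrow> OMap (PArr F (Idt P A)) x = x"
    and comp: "\<And>f g A B D x. f \<in> Hom P A B \<Longrightarrow> g \<in> Hom P B D \<Longrightarrow> x \<in> S A \<Longrightarrow>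
      OMap (PArr F (g \<cdot>\<^bsub>P\<^esub> f)) x = OMap (PArr F g) (OMap (PArr F f) x)"
    and PComp: "\<And>f g A B D x. f \<in> Hom P A B \<Longrightarrow> g \<in> Hom P B D \<Longrightarrow> x \<in> S A \<Longrightarrow>
      PComp F g f x = OMap (PArr F g) (OMap (PArr F f) x)"
  shows "normal_pseudofunctor (locally_discrete P) F"
proof -
  interpret P: category P by fact
  interpret L: two_category "locally_discrete P" by (rule two_category_locally_discrete[OF P])
  have ob: "A \<in> Obj P" "B \<in> Obj P" if "f \<in> Hom P A B" for f A B
    using that P.Dom_in_Obj P.Cod_in_Obj by (auto simp: Hom_def)
  have fct: "cat_functor (PObj F A) (PObj F B) (PArr F f)" if "f \<in> Hom P A B" for f A B
    unfolding obj[OF ob(1)[OF that]] obj[OF ob(2)[OF that]]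
    by (rule cat_functor_discrete) (use arr[OF that] AMap[OF that] in auto)
  show ?thesis
  proof (intro normal_pseudofunctor.intro normal_pseudofunctor_axioms.intro L.two_category_axioms,
      unfold locally_discrete_simps Hom_locally_discrete vcat_locally_discrete)
    show "category (PObj F A)" if "A \<in> Obj P" for A
      by (simp add: obj[OF that] category_discrete_cat)
    show "cat_functor (PObj F A) (PObj F B) (PArr F f)" if "f \<in> Hom P A B" for f A B
      by (rule fct[OF that])
    show "nat_trans (PObj F A) (PObj F B) (PArr F f) (PArr F g) (PCell F \<alpha>)"
      if f: "f \<in> Hom P A B" and \<alpha>: "\<alpha> \<in> Hom (discrete_cat (Arr P)) f g" for f g \<alpha> A B
    proof -
      have [simp]: "\<alpha> = f" "g = f" using \<alpha> by auto
      have "nat_iso (PObj F A) (PObj F B) (PArr F f) (PArr F f) (PCell F f)"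
        using fct[OF f] unfolding obj[OF ob(1)[OF f]] obj[OF ob(2)[OF f]]
        by (rule nat_iso_discrete) (use AMap[OF f] cell[OF f] in auto)
      then show ?thesis by (simp add: nat_iso.axioms)
    qed
    show "PCell F f x = Idt (PObj F B) (OMap (PArr F f) x)"
      if "f \<in> Hom P A B" "x \<in> Obj (PObj F A)" for f A B x
      using that ob[OF that(1)] cell[OF that(1)] by (simp add: obj)
    \<comment> \<open>\<open>VComp\<close> returns its right argument, so unfolding has already
      turned \<open>\<beta> \<bullet> \<alpha>\<close> into \<open>\<alpha>\<close>.\<close>
    show "PCell F \<alpha> x = PCell F \<beta> x \<cdot>\<^bsub>PObj F B\<^esub> PCell F \<alpha> x"
      if "f \<in> Hom P A B" for f A B \<alpha> \<beta> x
      using ob[OF that] by (simp add: obj)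
    show "OMap (PArr F (Idt P A)) x = x" if "A \<in> Obj P" "x \<in> Obj (PObj F A)" for A x
      using that by (simp add: obj idt)
    show "AMap (PArr F (Idt P A)) y = y" if "A \<in> Obj P" "y \<in> Arr (PObj F A)" for A y
      using that AMap[OF P.Idt_in_Hom[OF that(1)]] by (simp add: obj idt)
    show "nat_iso (PObj F A) (PObj F D) (comp_fctr (PArr F g) (PArr F f)) (PArr F (g \<cdot>\<^bsub>P\<^esub> f)) (PComp F g f)"
      if f: "f \<in> Hom P A B" and g: "g \<in> Hom P B D" for f g A B D
      unfolding obj[OF ob(1)[OF f]] obj[OF ob(2)[OF g]]
      by (rule nat_iso_discrete, rule cat_functor_discrete)
        (auto simp: comp_fctr_def AMap[OF f] AMap[OF g] AMap[OF P.Comp_in_Hom[OF f g]]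
          comp[OF f g] PComp[OF f g] arr[OF f] arr[OF g])
    show "PComp F g' f' x \<cdot>\<^bsub>PObj F D\<^esub>
        (PCell F \<beta> (OMap (PArr F f') x) \<cdot>\<^bsub>PObj F D\<^esub> AMap (PArr F g) (PCell F \<alpha> x)) =
        PCell F (\<beta> \<cdot>\<^bsub>P\<^esub> \<alpha>) x \<cdot>\<^bsub>PObj F D\<^esub> PComp F g f x"
      if "f \<in> Hom P A B" "g \<in> Hom P B D" "\<alpha> \<in> Hom (discrete_cat (Arr P)) f f'"
        "\<beta> \<in> Hom (discrete_cat (Arr P)) g g'" "x \<in> Obj (PObj F A)" for f g f' g' \<alpha> \<beta> x A B D
      using that ob[OF that(1)] ob[OF that(2)] cell[OF that(1)] AMap[OF that(2)] arr[OF that(1)]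
        PComp[OF that(1,2)]
      by (simp add: obj)
    show "PComp F (h \<cdot>\<^bsub>P\<^esub> g) f x \<cdot>\<^bsub>PObj F E\<^esub> PComp F h g (OMap (PArr F f) x) =
        PComp F h (g \<cdot>\<^bsub>P\<^esub> f) x \<cdot>\<^bsub>PObj F E\<^esub> AMap (PArr F h) (PComp F g f x)"
      if "f \<in> Hom P A B" "g \<in> Hom P B D" "h \<in> Hom P D E" "x \<in> Obj (PObj F A)" for f g h x A B D E
      using that ob[OF that(1)] ob[OF that(3)] AMap[OF that(3)] arr[OF that(1)] arr[OF that(2)]
        PComp[OF that(1,2)] PComp[OF that(2,3)]
      by (simp add: obj)
    show "PComp F f (Idt P A) x = Idt (PObj F B) (OMap (PArr F f) x)"
      if "f \<in> Hom P A B" "x \<in> Obj (PObj F A)" for f x A B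
      using that ob[OF that(1)] PComp[OF P.Idt_in_Hom[OF ob(1)[OF that(1)]] that(1)]
      by (simp add: obj idt)
    show "PComp F (Idt P B) f x = Idt (PObj F B) (OMap (PArr F f) x)"
      if "f \<in> Hom P A B" "x \<in> Obj (PObj F A)" for f x A B
      using that ob[OF that(1)] PComp[OF that(1) P.Idt_in_Hom[OF ob(2)[OF that(1)]]]
        arr[OF that(1)]
      by (simp add: obj idt)
  qed
qed

section \<open>The 2-ideal of an ideal\<close>

text \<open>Restricting the values of \<open>Hom(-,-)\<close> to null morphisms changes nothing
  else, because an ideal is stable under composition on both sides. Taking \<open>N = Arr C\<close>
  gives back \<open>Hom(-,-)\<close> itself.\<close>

definition discrete_pfunctor ::
    "('o, 'a) cat \<Rightarrow> 'a set \<Rightarrow> ('o \<times> 'o, 'a \<times> 'a, 'a \<times> 'a, 'a, 'a) pfunctor" where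
  "discrete_pfunctor C N = (hom_pfunctor (locally_discrete C))
     \<lparr>PObj := (\<lambda>(A, B). discrete_cat (N \<inter> Hom C A B))\<rparr>"

text \<open>The components of the transformation are inclusions. Since \<open>N(a, b)(n)\<close> is
  strictly \<open>b n a\<close>, the structure 2-cells are identities, each written as its
  underlying 1-cell.\<close>

definition discrete_two_ideal ::
    "('o, 'a) cat \<Rightarrow> 'a set \<Rightarrow> ('o, 'a, 'a, 'a, 'a) two_ideal_data" where
  "discrete_two_ideal C N = \<lparr>
     NPf = discrete_pfunctor C N,
     NNu = \<lparr>NComp = (\<lambda>_. id_fctr), NCell = (\<lambda>(a, b) n. b \<cdot>\<^bsub>C\<^esub> n \<cdot>\<^bsub>C\<^esub> a)\<rparr>\<rparr>"

lemma discrete_pfunctor_simps [simp]: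
  "PObj (discrete_pfunctor C N) (A, B) = discrete_cat (N \<inter> Hom C A B)"
  "OMap (PArr (discrete_pfunctor C N) (a, b)) n = b \<cdot>\<^bsub>C\<^esub> n \<cdot>\<^bsub>C\<^esub> a"
  "AMap (PArr (discrete_pfunctor C N) (a, b)) n = b \<cdot>\<^bsub>C\<^esub> n \<cdot>\<^bsub>C\<^esub> a"
  "PCell (discrete_pfunctor C N) (a, b) n = b \<cdot>\<^bsub>C\<^esub> n \<cdot>\<^bsub>C\<^esub> a"
  "PComp (discrete_pfunctor C N) (a', b') (a, b) n = b' \<cdot>\<^bsub>C\<^esub> b \<cdot>\<^bsub>C\<^esub> n \<cdot>\<^bsub>C\<^esub> (a \<cdot>\<^bsub>C\<^esub> a')"
  by (simp_all add: discrete_pfunctor_def hom_pfunctor_def)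

lemma hom_pfunctor_locally_discrete:
  "hom_pfunctor (locally_discrete C) = discrete_pfunctor C (Arr C)"
proof -
  have "Arr C \<inter> Hom C A B = Hom C A B" for A B by (auto simp: Hom_def)
  then show ?thesis by (simp add: discrete_pfunctor_def hom_pfunctor_def)
qed

text \<open>This is functoriality of \<open>n \<mapsto> b n a\<close>. The brackets on the left are
  those of \<open>hom_pfunctor\<close>, with the first component composed contravariantly.\<close>

lemma (in category) Comp_bracket:
  assumes x: "x \<in> Hom C A B" and a: "a \<in> Hom C A' A" and b: "b \<in> Hom C B B'"
    and a': "a' \<in> Hom C A'' A'" and b': "b' \<in> Hom C B' B''"
  shows "b' \<cdot> b \<cdot> x \<cdot> (a \<cdot> a') = b' \<cdot> (b \<cdot> x \<cdot> a) \<cdot> a'"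
proof -
  have y: "b \<cdot> x \<in> Hom C A B'" by (rule Comp_in_Hom[OF x b])
  have ya: "b \<cdot> x \<cdot> a \<in> Hom C A' B'" by (rule Comp_in_Hom[OF a y])
  show ?thesis
    using Comp_assoc[OF x b b'] Comp_assoc[OF Comp_in_Hom[OF a' a] y b'] Comp_assoc[OF a' a y]
      Comp_assoc[OF a' ya b'] by simp
qed

lemma null_ideal_compD:
  assumes "null_ideal C N" "n \<in> N" "n \<in> Hom C A B"
  shows "a \<in> Hom C A' A \<Longrightarrow> n \<cdot>\<^bsub>C\<^esub> a \<in> N" "b \<in> Hom C B B' \<Longrightarrow> b \<cdot>\<^bsub>C\<^esub> n \<in> N"
  using assms by (auto simp: null_ideal_def Hom_def)

text \<open>It lets \<open>Hom(-,-)\<close> and the null subfunctor be handled by one and the same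
  pseudofunctor lemma.\<close>

lemma null_ideal_Arr:
  fixes C :: "('o, 'a) cat"
  assumes "category C"
  shows "null_ideal C (Arr C)"
proof -
  interpret category C by fact
  have "g \<cdot>\<^bsub>C\<^esub> f \<in> Arr C" if "f \<in> Arr C" "g \<in> Arr C" "Cod C f = Dom C g" for f g
    using Comp_in_Hom[of f "Dom C f" "Cod C f" g "Cod C g"] that by (simp add: Hom_def)
  then show ?thesis by (auto simp: null_ideal_def)
qed

lemma normal_pseudofunctor_discrete:
  fixes C :: "('o, 'a) cat"
  assumes C: "category C" and N: "null_ideal C N"
  shows "normal_pseudofunctor (locally_discrete (cat_prod (cat_op C) C)) (discrete_pfunctor C N)"
proof (rule normal_pseudofunctor_locally_discrete
    [where S = "\<lambda>X. N \<inter> Hom C (fst X) (snd X)", OF category_cat_prod[OF category_cat_op[OF C] C]])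
  interpret category C by fact
  let ?P = "cat_prod (cat_op C) C" and ?F = "discrete_pfunctor C N"
  \<comment> \<open>The first component of an arrow of the product runs backwards in
    \<open>C\<close>.\<close>
  have pair: "f \<in> Hom ?P A B \<longleftrightarrow>
      (\<exists>a b. f = (a, b) \<and> a \<in> Hom C (fst B) (fst A) \<and> b \<in> Hom C (snd A) (snd B))" for f A B
    by (cases A; cases B) auto
  show "PObj ?F A = discrete_cat (N \<inter> Hom C (fst A) (snd A))" for A
    by (cases A) simp
  show "OMap (PArr ?F f) x \<in> N \<inter> Hom C (fst B) (snd B)"
    if f: "f \<in> Hom ?P A B" and x: "x \<in> N \<inter> Hom C (fst A) (snd A)" for f A B x
  proof -
    obtain a b where ab: "f = (a, b)" "a \<in> Hom C (fst B) (fst A)" "b \<in> Hom C (snd A) (snd B)"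
      using f unfolding pair by blast
    have x': "x \<in> N" "x \<in> Hom C (fst A) (snd A)" using x by auto
    have bx: "b \<cdot>\<^bsub>C\<^esub> x \<in> N" "b \<cdot>\<^bsub>C\<^esub> x \<in> Hom C (fst A) (snd B)"
      using null_ideal_compD(2)[OF N x' ab(3)] Comp_in_Hom[OF x'(2) ab(3)] .
    show ?thesis
      using null_ideal_compD(1)[OF N bx ab(2)] Comp_in_Hom[OF ab(2) bx(2)] ab(1) by simp
  qed
  show "AMap (PArr ?F f) x = OMap (PArr ?F f) x" for f x
    by (cases f) simp
  show "PCell ?F f x = OMap (PArr ?F f) x" for f x
    by (cases f) simp
  show "OMap (PArr ?F (Idt ?P A)) x = x"
    if "A \<in> Obj ?P" "x \<in> N \<inter> Hom C (fst A) (snd A)" for A x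
    using that by (auto simp: Comp_Idt Idt_Comp)
  show "OMap (PArr ?F (g \<cdot>\<^bsub>?P\<^esub> f)) x = OMap (PArr ?F g) (OMap (PArr ?F f) x)"
    if "f \<in> Hom ?P A B" "g \<in> Hom ?P B D" "x \<in> N \<inter> Hom C (fst A) (snd A)" for f g A B D x
    using that unfolding pair by (auto intro: Comp_bracket)
  show "PComp ?F g f x = OMap (PArr ?F g) (OMap (PArr ?F f) x)"
    if "f \<in> Hom ?P A B" "g \<in> Hom ?P B D" "x \<in> N \<inter> Hom C (fst A) (snd A)" for f g A B D x
    using that unfolding pair by (auto intro: Comp_bracket)
qed

text \<open>Inclusions commute strictly with restriction, so naturality and units are immediate; the
  composition axiom reduces to reassociation. Injectivity and faithfulness hold because the
  inclusions are identity maps.\<close>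

lemma two_ideal_discrete:
  fixes C :: "('o, 'a) cat"
  assumes C: "category C" and N: "null_ideal C N"
  shows "two_ideal (locally_discrete C) (discrete_two_ideal C N)"
proof -
  interpret category C by fact
  let ?P = "cat_prod (cat_op C) C" and ?F = "discrete_pfunctor C N"
    and ?G = "discrete_pfunctor C (Arr C)"
    and ?nu = "\<lparr>NComp = \<lambda>_. id_fctr, NCell = \<lambda>(a, b) n. b \<cdot>\<^bsub>C\<^esub> n \<cdot>\<^bsub>C\<^esub> a\<rparr>
      :: ('o \<times> 'o, 'a \<times> 'a, 'a, 'a, 'a, 'a) pnat"
  interpret F: normal_pseudofunctor "locally_discrete ?P" ?F
    by (rule normal_pseudofunctor_discrete[OF C N])
  interpret G: normal_pseudofunctor "locally_discrete ?P" ?G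
    by (rule normal_pseudofunctor_discrete[OF C null_ideal_Arr[OF C]])
  have "pseudonatural (locally_discrete ?P) ?F ?G ?nu"
  proof (intro pseudonatural.intro pseudonatural_axioms.intro
      F.normal_pseudofunctor_axioms G.normal_pseudofunctor_axioms,
      unfold locally_discrete_simps Hom_locally_discrete vcat_locally_discrete)
    show NC: "cat_functor (PObj ?F A) (PObj ?G A) (NComp ?nu A)" for A
      by (cases A) (auto simp: id_fctr_def Hom_def intro!: cat_functor_discrete)
    show "nat_iso (PObj ?F A) (PObj ?G B) (comp_fctr (PArr ?G f) (NComp ?nu A))
        (comp_fctr (NComp ?nu B) (PArr ?F f)) (NCell ?nu f)" if "f \<in> Hom ?P A B" for f A B
    proof -
      obtain A1 A2 B1 B2 a b where [simp]: "A = (A1, A2)" "B = (B1, B2)" "f = (a, b)"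
        by (metis surj_pair)
      have "b \<cdot>\<^bsub>C\<^esub> x \<cdot>\<^bsub>C\<^esub> a \<in> Hom C B1 B2" if "x \<in> Hom C A1 A2" for x
        using \<open>f \<in> Hom ?P A B\<close> that by (auto intro!: Comp_in_Hom)
      then show ?thesis
        by (auto simp: comp_fctr_def id_fctr_def Hom_def intro!: nat_iso_discrete cat_functor_discrete)
    qed
    show "NCell ?nu g x \<cdot>\<^bsub>PObj ?G B\<^esub> PCell ?G \<alpha> (OMap (NComp ?nu A) x) =
        AMap (NComp ?nu B) (PCell ?F \<alpha> x) \<cdot>\<^bsub>PObj ?G B\<^esub> NCell ?nu f x"
      if "\<alpha> \<in> Hom (discrete_cat (Arr ?P)) f g" for f g \<alpha> A B x
      using that by (cases f; cases B) (auto simp: id_fctr_def)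
    show "NCell ?nu (g \<cdot>\<^bsub>?P\<^esub> f) x \<cdot>\<^bsub>PObj ?G D\<^esub> PComp ?G g f (OMap (NComp ?nu A) x) =
        AMap (NComp ?nu D) (PComp ?F g f x) \<cdot>\<^bsub>PObj ?G D\<^esub>
          (NCell ?nu g (OMap (PArr ?F f) x) \<cdot>\<^bsub>PObj ?G D\<^esub> AMap (PArr ?G g) (NCell ?nu f x))"
      if fg: "f \<in> Hom ?P A B" "g \<in> Hom ?P B D" and x: "x \<in> Obj (PObj ?F A)" for f g A B D x
    proof -
      obtain A1 A2 B1 B2 D1 D2 a b a' b' where
        [simp]: "A = (A1, A2)" "B = (B1, B2)" "D = (D1, D2)" "f = (a, b)" "g = (a', b')"
        by (metis surj_pair)
      \<comment> \<open>Discrete composition keeps only the right factor: the left side of the goal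
        reduces to \<open>PComp\<close> of \<open>Hom(-,-)\<close>, the right side to one
        restriction after the other.\<close>
      have "b' \<cdot>\<^bsub>C\<^esub> b \<cdot>\<^bsub>C\<^esub> x \<cdot>\<^bsub>C\<^esub> (a \<cdot>\<^bsub>C\<^esub> a') = b' \<cdot>\<^bsub>C\<^esub> (b \<cdot>\<^bsub>C\<^esub> x \<cdot>\<^bsub>C\<^esub> a) \<cdot>\<^bsub>C\<^esub> a'"
        by (rule Comp_bracket) (use fg x in auto)
      then show ?thesis by (simp add: id_fctr_def)
    qed
    show "NCell ?nu (Idt ?P A) x = Idt (PObj ?G A) (OMap (NComp ?nu A) x)"
      if "A \<in> Obj ?P" "x \<in> Obj (PObj ?F A)" for A x
      using that by (cases A) (auto simp: id_fctr_def Comp_Idt Idt_Comp)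
  qed
  then show ?thesis
    using F.normal_pseudofunctor_axioms two_category_locally_discrete[OF C]
    by (simp add: two_ideal_def discrete_two_ideal_def hom_pfunctor_locally_discrete
        null_mor_def null_2cell_def id_fctr_def inj_on_def)
qed

text \<open>
  Only the values on composable arrows are prescribed: the dual of \<^term>\<open>discrete_two_ideal C N\<close>
  brackets composites the other way round, and bracketing matters on ill-typed arguments.
\<close>

definition represents ::
    "('o, 'a) cat \<Rightarrow> 'a set \<Rightarrow> ('o, 'a, 'a, 'a, 'a) two_ideal_data \<Rightarrow> bool" where
  "represents C N I \<longleftrightarrow>
     (\<forall>A B. null_cat I A B = discrete_cat (N \<inter> Hom C A B)) \<and>
     (\<forall>A B n. null_mor I A B n = n \<and> null_2cell I A B n = n) \<and>
     (\<forall>A' A B B' a n b. a \<in> Hom C A' A \<longrightarrow> n \<in> Hom C A B \<longrightarrow> b \<in> Hom C B B' \<longrightarrow>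
        restr I a b n = b \<cdot>\<^bsub>C\<^esub> n \<cdot>\<^bsub>C\<^esub> a \<and> nu I a b n = b \<cdot>\<^bsub>C\<^esub> n \<cdot>\<^bsub>C\<^esub> a)"

lemma representsD:
  assumes "represents C N I"
  shows "null_cat I A B = discrete_cat (N \<inter> Hom C A B)" "null_mor I A B m = m" "null_2cell I A B m = m"
    and "a \<in> Hom C A' A \<Longrightarrow> n \<in> Hom C A B \<Longrightarrow> b \<in> Hom C B B' \<Longrightarrow> restr I a b n = b \<cdot>\<^bsub>C\<^esub> n \<cdot>\<^bsub>C\<^esub> a"
    and "a \<in> Hom C A' A \<Longrightarrow> n \<in> Hom C A B \<Longrightarrow> b \<in> Hom C B B' \<Longrightarrow> nu I a b n = b \<cdot>\<^bsub>C\<^esub> n \<cdot>\<^bsub>C\<^esub> a"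
proof -
  note I = assms[unfolded represents_def]
  show "null_cat I A B = discrete_cat (N \<inter> Hom C A B)"
    by (rule I[THEN conjunct1, rule_format])
  show "null_mor I A B m = m" "null_2cell I A B m = m"
    by (rule I[THEN conjunct2, THEN conjunct1, rule_format, THEN conjunct1]
        I[THEN conjunct2, THEN conjunct1, rule_format, THEN conjunct2])+
  assume *: "a \<in> Hom C A' A" "n \<in> Hom C A B" "b \<in> Hom C B B'"
  show "restr I a b n = b \<cdot>\<^bsub>C\<^esub> n \<cdot>\<^bsub>C\<^esub> a" "nu I a b n = b \<cdot>\<^bsub>C\<^esub> n \<cdot>\<^bsub>C\<^esub> a"
    using I[THEN conjunct2, THEN conjunct2, rule_format, OF *] by simp_all
qed

lemma represents_discrete_two_ideal: "represents C N (discrete_two_ideal C N)"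
  by (simp add: represents_def discrete_two_ideal_def null_cat_def null_mor_def null_2cell_def
      restr_def nu_def id_fctr_def)

text \<open>\<open>ideal_op\<close> merely swaps paired arguments. The discrepancy left over is
  \<open>(a n) b\<close> against \<open>a (n b)\<close>, which associativity removes on composable
  arrows.\<close>

lemma represents_op:
  fixes C :: "('o, 'a) cat"
  assumes "category C" and I: "represents C N I"
  shows "represents (cat_op C) N (ideal_op I)"
proof -
  interpret category C by fact
  have eq: "null_cat (ideal_op I) A B = null_cat I B A"
    "null_mor (ideal_op I) A B = null_mor I B A" "null_2cell (ideal_op I) A B = null_2cell I B A"
    "restr (ideal_op I) a b = restr I b a" "nu (ideal_op I) a b = nu I b a" for A B a b
    by (simp_all add: ideal_op_def null_cat_def null_mor_def null_2cell_def restr_def nu_def fun_eq_iff)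
  show ?thesis
    using I unfolding represents_def eq by (auto simp: Comp_assoc)
qed

section \<open>Kernels and 2-kernels\<close>

lemma is_kernel_typed:
  assumes "is_kernel C N f k"
  shows "f \<in> Hom C (Dom C f) (Cod C f)" "k \<in> Hom C (Dom C k) (Dom C f)" "f \<cdot>\<^bsub>C\<^esub> k \<in> N"
  using assms unfolding is_kernel_def Hom_def by blast+

lemma is_kernel_lift_unique:
  assumes k: "is_kernel C N f k" and z: "z \<in> Hom C Z (Dom C f)" and fz: "f \<cdot>\<^bsub>C\<^esub> z \<in> N"
  shows "\<exists>!u. u \<in> Hom C Z (Dom C k) \<and> k \<cdot>\<^bsub>C\<^esub> u = z"
proof -
  have "z \<in> Arr C" "Dom C z = Z" "Cod C z = Dom C f \<and> f \<cdot>\<^bsub>C\<^esub> z \<in> N"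
    using z fz by (simp_all add: Hom_def)
  moreover have "\<forall>z \<in> Arr C. Cod C z = Dom C f \<and> f \<cdot>\<^bsub>C\<^esub> z \<in> N \<longrightarrow>
      (\<exists>!u. u \<in> Hom C (Dom C z) (Dom C k) \<and> k \<cdot>\<^bsub>C\<^esub> u = z)"
    using k unfolding is_kernel_def by (elim conjE)
  ultimately show ?thesis by blast
qed

lemma is_kernel_lift:
  assumes "is_kernel C N f k" "z \<in> Hom C Z (Dom C f)" "f \<cdot>\<^bsub>C\<^esub> z \<in> N"
  obtains u where "u \<in> Hom C Z (Dom C k)" "k \<cdot>\<^bsub>C\<^esub> u = z"
  using is_kernel_lift_unique[OF assms] by blast

text \<open>Kernels are monic: \<open>f (k u) = (f k) u\<close> is null, so \<open>k u\<close>
  factors uniquely through \<open>k\<close>, and \<open>u\<close> and \<open>v\<close> are two such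
  factorizations.\<close>

lemma is_kernel_cancel:
  fixes C :: "('o, 'a) cat"
  assumes "category C" "null_ideal C N" and k: "is_kernel C N f k"
    and u: "u \<in> Hom C Z (Dom C k)" and v: "v \<in> Hom C Z (Dom C k)"
    and eq: "k \<cdot>\<^bsub>C\<^esub> u = k \<cdot>\<^bsub>C\<^esub> v"
  shows "u = v"
proof -
  interpret category C by fact
  note kt = is_kernel_typed[OF k]
  have ku: "k \<cdot>\<^bsub>C\<^esub> u \<in> Hom C Z (Dom C f)" by (rule Comp_in_Hom[OF u kt(2)])
  have fk: "f \<cdot>\<^bsub>C\<^esub> k \<in> N" "f \<cdot>\<^bsub>C\<^esub> k \<in> Hom C (Dom C k) (Cod C f)"
    using kt(3) Comp_in_Hom[OF kt(2,1)] .
  have "f \<cdot>\<^bsub>C\<^esub> (k \<cdot>\<^bsub>C\<^esub> u) \<in> N"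
    using null_ideal_compD(1)[OF assms(2) fk u] Comp_assoc[OF u kt(2) kt(1)] by simp
  from is_kernel_lift_unique[OF k ku this] show ?thesis
    using u v eq by metis
qed

text \<open>The last two premises mirror conditions (1) and (2) of a 2-kernel: existence of
  factorizations, and monicity as the remnant of lifting 2-cells.\<close>

lemma is_kernelI:
  assumes "f \<in> Hom C A B" "k \<in> Hom C K A" "f \<cdot>\<^bsub>C\<^esub> k \<in> N"
    and "\<And>Z z. z \<in> Hom C Z A \<Longrightarrow> f \<cdot>\<^bsub>C\<^esub> z \<in> N \<Longrightarrow> \<exists>u \<in> Hom C Z K. k \<cdot>\<^bsub>C\<^esub> u = z"
    and "\<And>Z u v. u \<in> Hom C Z K \<Longrightarrow> v \<in> Hom C Z K \<Longrightarrow> k \<cdot>\<^bsub>C\<^esub> u = k \<cdot>\<^bsub>C\<^esub> v \<Longrightarrow> u = v"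
  shows "is_kernel C N f k"
  unfolding is_kernel_def
proof (intro conjI ballI impI)
  fix z assume z: "z \<in> Arr C" "Cod C z = Dom C f \<and> f \<cdot>\<^bsub>C\<^esub> z \<in> N"
  have *: "Dom C f = A" "Dom C k = K" using assms(1,2) by (auto simp: Hom_def)
  have "\<exists>u \<in> Hom C (Dom C z) K. k \<cdot>\<^bsub>C\<^esub> u = z"
    by (rule assms(4)) (use z * in \<open>auto simp: Hom_def\<close>)
  then show "\<exists>!u. u \<in> Hom C (Dom C z) (Dom C k) \<and> k \<cdot>\<^bsub>C\<^esub> u = z"
    unfolding * using assms(5) by blast
qed (use assms(1-3) in \<open>auto simp: Hom_def\<close>)

text \<open>A 2-cell is an equality, so the null morphism and the structure cell are both forced to
  be the composite of \<open>f\<close> and \<open>k\<close>. Condition (1) then says that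
  \<open>z\<close> factors through \<open>k\<close> whenever \<open>f z\<close> is null, and
  condition (2) that \<open>k\<close> is monic.\<close>

lemma two_kernel_locally_discrete:
  fixes C :: "('o, 'a) cat"
  assumes C: "category C" and N: "null_ideal C N" and I: "represents C N I"
  shows "two_kernel (locally_discrete C) I f k n \<alpha> \<longleftrightarrow>
    is_kernel C N f k \<and> n = f \<cdot>\<^bsub>C\<^esub> k \<and> \<alpha> = f \<cdot>\<^bsub>C\<^esub> k"
proof -
  interpret category C by fact
  have null [simp]: "null_cat I A B = discrete_cat (N \<inter> Hom C A B)" "null_mor I A B m = m"
    "null_2cell I A B m = m" for A B m
    by (simp_all add: representsD[OF I])
  have nul: "restr I u (Idt C B) m = m \<cdot>\<^bsub>C\<^esub> u" "nu I u (Idt C B) m = m \<cdot>\<^bsub>C\<^esub> u"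
    if "u \<in> Hom C Z K" "m \<in> Hom C K B" for u m Z K B
  proof -
    have "B \<in> Obj C" using that(2) Cod_in_Obj by (auto simp: Hom_def)
    then show "restr I u (Idt C B) m = m \<cdot>\<^bsub>C\<^esub> u" "nu I u (Idt C B) m = m \<cdot>\<^bsub>C\<^esub> u"
      using representsD(4,5)[OF I that Idt_in_Hom] Idt_Comp[OF that(2)] by simp_all
  qed
  have Arr: "f \<in> Arr C" if "f \<in> Hom C A B" for f A B
    using that by (simp add: Hom_def)
  show ?thesis
  proof
    \<comment> \<open>The chains of vertical composites in the definition collapse to their
      rightmost factor, the inverse of \<open>\<beta>\<close> or of the \<open>nu\<close>
      cell.\<close>
    assume "two_kernel (locally_discrete C) I f k n \<alpha>"
    then obtain K A B where f: "f \<in> Hom C A B" and k: "k \<in> Hom C K A"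
      and n': "n \<in> N \<inter> Hom C K B" and \<alpha>': "\<alpha> \<in> Isos (discrete_cat (Arr C)) (f \<cdot>\<^bsub>C\<^esub> k) n"
      and lift: "\<forall>Z z p \<beta>. z \<in> Hom C Z A \<and> p \<in> N \<inter> Hom C Z B \<and>
         \<beta> \<in> Isos (discrete_cat (Arr C)) (f \<cdot>\<^bsub>C\<^esub> z) p \<longrightarrow>
         (\<exists>u \<in> Hom C Z K. \<exists>\<gamma> \<in> Isos (discrete_cat (Arr C)) z (k \<cdot>\<^bsub>C\<^esub> u).
            is_null_iso I Z B p (restr I u (Idt C B) n) (inverse_of (discrete_cat (Arr C)) \<beta>))"
      and uniq: "\<forall>Z u v l. u \<in> Hom C Z K \<and> v \<in> Hom C Z K \<and>
         l \<in> Hom (discrete_cat (Arr C)) (k \<cdot>\<^bsub>C\<^esub> u) (k \<cdot>\<^bsub>C\<^esub> v) \<and>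
         is_null_2cell I Z B (restr I u (Idt C B) n) (restr I v (Idt C B) n)
           (inverse_of (discrete_cat (Arr C)) (nu I u (Idt C B) n)) \<longrightarrow>
         (\<exists>!\<mu>. \<mu> \<in> Hom (discrete_cat (Arr C)) u v \<and> k \<cdot>\<^bsub>C\<^esub> \<mu> = l)"
      unfolding two_kernel_def locally_discrete_simps Hom_locally_discrete vcat_locally_discrete
        null discrete_cat_simps
      by (elim exE conjE) (rule that)
    have n: "n \<in> N" "n \<in> Hom C K B" and \<alpha>: "\<alpha> = f \<cdot>\<^bsub>C\<^esub> k" "n = f \<cdot>\<^bsub>C\<^esub> k"
      using n' \<alpha>' by auto
    have "is_kernel C N f k"
    proof (rule is_kernelI[OF f k])
      show "f \<cdot>\<^bsub>C\<^esub> k \<in> N" using n \<alpha> by simp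
      show "\<exists>u \<in> Hom C Z K. k \<cdot>\<^bsub>C\<^esub> u = z" if z: "z \<in> Hom C Z A" and fz: "f \<cdot>\<^bsub>C\<^esub> z \<in> N" for Z z
      proof -
        have "f \<cdot>\<^bsub>C\<^esub> z \<in> N \<inter> Hom C Z B"
          "f \<cdot>\<^bsub>C\<^esub> z \<in> Isos (discrete_cat (Arr C)) (f \<cdot>\<^bsub>C\<^esub> z) (f \<cdot>\<^bsub>C\<^esub> z)"
          using fz Comp_in_Hom[OF z f] Arr[OF Comp_in_Hom[OF z f]] by simp_all
        then obtain u \<gamma> where "u \<in> Hom C Z K" "\<gamma> \<in> Isos (discrete_cat (Arr C)) z (k \<cdot>\<^bsub>C\<^esub> u)"
          using lift z by blast
        then show ?thesis by (intro bexI[of _ u]) simp_all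
      qed
      show "u = v" if u: "u \<in> Hom C Z K" and v: "v \<in> Hom C Z K" and eq: "k \<cdot>\<^bsub>C\<^esub> u = k \<cdot>\<^bsub>C\<^esub> v" for Z u v
      proof -
        \<comment> \<open>Condition (2) is used for the identity 2-cell on \<open>k u = k v\<close>.
          Its null premise holds because \<open>n u\<close> and \<open>n v\<close> are the same null
          morphism, and a lift \<open>u \<Rightarrow> v\<close> is an equality.\<close>
        have "n \<cdot>\<^bsub>C\<^esub> u = n \<cdot>\<^bsub>C\<^esub> v"
          using Comp_assoc[OF u k f] Comp_assoc[OF v k f] eq \<alpha> by simp
        moreover have "n \<cdot>\<^bsub>C\<^esub> u \<in> N" "n \<cdot>\<^bsub>C\<^esub> u \<in> Hom C Z B"
          using null_ideal_compD(1)[OF N n u] Comp_in_Hom[OF u n(2)] by simp_all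
        ultimately have "is_null_2cell I Z B (restr I u (Idt C B) n) (restr I v (Idt C B) n)
            (inverse_of (discrete_cat (Arr C)) (nu I u (Idt C B) n))"
          unfolding is_null_2cell_def nul[OF u n(2)] nul[OF v n(2)]
          by (intro bexI[of _ "n \<cdot>\<^bsub>C\<^esub> u"]) (simp_all add: Arr)
        moreover have "k \<cdot>\<^bsub>C\<^esub> u \<in> Hom (discrete_cat (Arr C)) (k \<cdot>\<^bsub>C\<^esub> u) (k \<cdot>\<^bsub>C\<^esub> v)"
          using Arr[OF Comp_in_Hom[OF u k]] eq by simp
        ultimately obtain \<mu> where "\<mu> \<in> Hom (discrete_cat (Arr C)) u v"
          using uniq u v by blast
        then show ?thesis by simp
      qed
    qed
    with \<alpha> show "is_kernel C N f k \<and> n = f \<cdot>\<^bsub>C\<^esub> k \<and> \<alpha> = f \<cdot>\<^bsub>C\<^esub> k" by simp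
  next
    assume R: "is_kernel C N f k \<and> n = f \<cdot>\<^bsub>C\<^esub> k \<and> \<alpha> = f \<cdot>\<^bsub>C\<^esub> k"
    then have ker: "is_kernel C N f k" by simp
    define K A B where "K = Dom C k" and "A = Dom C f" and "B = Cod C f"
    have f: "f \<in> Hom C A B" and k: "k \<in> Hom C K A"
      using is_kernel_typed[OF ker] by (simp_all add: K_def A_def B_def)
    have n: "n \<in> N" "n \<in> Hom C K B" and \<alpha>: "\<alpha> = n" "n = f \<cdot>\<^bsub>C\<^esub> k"
      using R is_kernel_typed(3)[OF ker] Comp_in_Hom[OF k f] by simp_all
    show "two_kernel (locally_discrete C) I f k n \<alpha>"
      unfolding two_kernel_def
      unfolding locally_discrete_simps Hom_locally_discrete vcat_locally_discrete
    proof (rule exI[of _ K], rule exI[of _ A], rule exI[of _ B], intro conjI allI impI)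
      show "n \<in> Obj (null_cat I K B)" using n by simp
      show "\<alpha> \<in> Isos (discrete_cat (Arr C)) (f \<cdot>\<^bsub>C\<^esub> k) (null_mor I K B n)"
        using n \<alpha> Arr by auto
    next
      fix Z z p \<beta> assume "z \<in> Hom C Z A \<and> p \<in> Obj (null_cat I Z B) \<and>
        \<beta> \<in> Isos (discrete_cat (Arr C)) (f \<cdot>\<^bsub>C\<^esub> z) (null_mor I Z B p)"
      then have z: "z \<in> Hom C Z A" and p: "p \<in> Obj (null_cat I Z B)"
        and \<beta>: "\<beta> \<in> Isos (discrete_cat (Arr C)) (f \<cdot>\<^bsub>C\<^esub> z) (null_mor I Z B p)"
        by auto
      have eq: "p = f \<cdot>\<^bsub>C\<^esub> z" "\<beta> = p" "p \<in> Arr C" "p \<in> N" "p \<in> Hom C Z B" using p \<beta> by auto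
      then have "f \<cdot>\<^bsub>C\<^esub> z \<in> N" by simp
      then obtain u where u: "u \<in> Hom C Z K" "k \<cdot>\<^bsub>C\<^esub> u = z"
        using is_kernel_lift[OF ker, of z Z] z unfolding A_def K_def by blast
      have "n \<cdot>\<^bsub>C\<^esub> u = p" using Comp_assoc[OF u(1) k f] \<alpha> u(2) eq by simp
      then show "\<exists>u \<in> Hom C Z K. \<exists>\<gamma> \<in> Isos (discrete_cat (Arr C)) z (k \<cdot>\<^bsub>C\<^esub> u).
          is_null_iso I Z B p (restr I u (Idt C B) n) (inverse_of (discrete_cat (Arr C)) \<beta>)"
        using u z eq nul[OF u(1) n(2)] Arr by (intro bexI[of _ u] bexI[of _ z]) (auto simp: is_null_iso_def)
    next
      fix Z u v l assume "u \<in> Hom C Z K \<and> v \<in> Hom C Z K \<and>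
        l \<in> Hom (discrete_cat (Arr C)) (k \<cdot>\<^bsub>C\<^esub> u) (k \<cdot>\<^bsub>C\<^esub> v) \<and>
        is_null_2cell I Z B (restr I u (Idt C B) n) (restr I v (Idt C B) n)
          (inverse_of (discrete_cat (Arr C)) (nu I u (Idt C B) n))"
      then have u: "u \<in> Hom C Z K" and v: "v \<in> Hom C Z K"
        and l: "l \<in> Hom (discrete_cat (Arr C)) (k \<cdot>\<^bsub>C\<^esub> u) (k \<cdot>\<^bsub>C\<^esub> v)"
        by auto
      \<comment> \<open>The 2-cell \<open>l\<close> witnesses \<open>k u = k v\<close>; after
        cancellation the unique lift is the identity of \<open>u\<close>.\<close>
      have "u = v"
        by (rule is_kernel_cancel[OF C N ker]) (use u v l in \<open>auto simp: K_def\<close>)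
      then show "\<exists>!\<mu>. \<mu> \<in> Hom (discrete_cat (Arr C)) u v \<and> k \<cdot>\<^bsub>C\<^esub> \<mu> = l"
        using u l Arr by auto
    qed (use f k in auto)
  qed
qed

section \<open>Exact categories as 2-exact 2-categories\<close>

lemma null_ideal_op: "null_ideal C N \<Longrightarrow> null_ideal (cat_op C) N"
  by (auto simp: null_ideal_def)

text \<open>Factoring through an object with null identity is self-dual: the two legs change
  places.\<close>

lemma closed_ideal_op:
  assumes "closed_ideal C N"
  shows "closed_ideal (cat_op C) N"
proof -
  have "null_ideal (cat_op C) N"
    using assms null_ideal_op[of C N] by (simp add: closed_ideal_def)
  moreover have "\<exists>E \<in> Obj C. Idt C E \<in> N \<and>
      (\<exists>a \<in> Hom C E (Cod C n). \<exists>b \<in> Hom C (Dom C n) E. n = a \<cdot>\<^bsub>C\<^esub> b)" if n: "n \<in> N" for n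
  proof -
    obtain E a b where "E \<in> Obj C" "Idt C E \<in> N" "a \<in> Hom C (Dom C n) E" "b \<in> Hom C E (Cod C n)"
        "n = b \<cdot>\<^bsub>C\<^esub> a"
      using assms n unfolding closed_ideal_def by meson
    then show ?thesis
      by (intro bexI[of _ E] conjI bexI[of _ b] bexI[of _ a])
  qed
  ultimately show ?thesis
    by (simp add: closed_ideal_def)
qed

lemma kernels_reflect_locally_discrete:
  fixes C :: "('o, 'a) cat"
  assumes C: "category C" and N: "closed_ideal C N" and I: "represents C N I"
  shows "kernels_reflect (locally_discrete C) I"
  unfolding kernels_reflect_def
proof (intro allI impI conjI)
  interpret category C by fact
  have N': "null_ideal C N" using N by (simp add: closed_ideal_def)
  have [simp]: "null_cat I A B = discrete_cat (N \<inter> Hom C A B)" "null_mor I A B m = m"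
    "null_2cell I A B m = m" for A B m
    by (simp_all add: representsD[OF I])
  have Arr: "f \<in> Arr C" if "f \<in> Hom C A B" for f A B
    using that by (simp add: Hom_def)
  fix f k n \<alpha> assume "two_kernel (locally_discrete C) I f k n \<alpha>"
  then have ker: "is_kernel C N f k"
    by (simp add: two_kernel_locally_discrete[OF C N' I])
  define K A where "K = Dom C k" and "A = Dom C f"
  have f: "f \<in> Hom C A (Cod C f)" and k: "k \<in> Hom C K A"
    using is_kernel_typed[OF ker] by (simp_all add: K_def A_def)
  have nul: "restr I (Idt C D) k s = k \<cdot>\<^bsub>C\<^esub> s" "nu I (Idt C D) k s = k \<cdot>\<^bsub>C\<^esub> s"
    if "s \<in> Hom C D K" for s D
  proof -
    have "D \<in> Obj C" using that Dom_in_Obj by (auto simp: Hom_def)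
    then show "restr I (Idt C D) k s = k \<cdot>\<^bsub>C\<^esub> s" "nu I (Idt C D) k s = k \<cdot>\<^bsub>C\<^esub> s"
      using representsD(4,5)[OF I Idt_in_Hom that k] Comp_Idt[OF Comp_in_Hom[OF that k]] by simp_all
  qed
  have refl: "s \<in> N" if s: "s \<in> Hom C D K" and ks: "k \<cdot>\<^bsub>C\<^esub> s \<in> N" for s D
  proof -
    have "k \<cdot>\<^bsub>C\<^esub> s \<in> Hom C D A" by (rule Comp_in_Hom[OF s k])
    then obtain E a b where E: "E \<in> Obj C" "Idt C E \<in> N" and a: "a \<in> Hom C D E"
        and b: "b \<in> Hom C E A" and ba: "k \<cdot>\<^bsub>C\<^esub> s = b \<cdot>\<^bsub>C\<^esub> a"
      using N ks unfolding closed_ideal_def by (fastforce simp: Hom_def)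
    note idE = Idt_in_Hom[OF E(1)]
    \<comment> \<open>Since \<open>f b = (f b) \<cdot> Idt C E\<close>, nullity of the identity of
      \<open>E\<close> passes to it.\<close>
    have "f \<cdot>\<^bsub>C\<^esub> b \<in> N"
      using null_ideal_compD(2)[OF N' E(2) idE Comp_in_Hom[OF b f]] Comp_Idt[OF Comp_in_Hom[OF b f]]
      by simp
    then obtain u where u: "u \<in> Hom C E K" "k \<cdot>\<^bsub>C\<^esub> u = b"
      using is_kernel_lift[OF ker, of b E] b unfolding A_def K_def by blast
    \<comment> \<open>Both sides agree after composition with the monic \<open>k\<close>:
      \<open>k (u a) = b a = k s\<close>.\<close>
    have "s = u \<cdot>\<^bsub>C\<^esub> a"
      using is_kernel_cancel[OF C N' ker, of s D "u \<cdot>\<^bsub>C\<^esub> a"] s Comp_in_Hom[OF a u(1)]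
        Comp_assoc[OF a u(1) k] u(2) ba by (simp add: K_def)
    moreover have "u \<in> N"
      using null_ideal_compD(2)[OF N' E(2) idE u(1)] Comp_Idt[OF u(1)] by simp
    ultimately show ?thesis
      using null_ideal_compD(1)[OF N' _ u(1) a] by simp
  qed
  show "reflects_null_morphisms (locally_discrete C) I k"
    unfolding reflects_null_morphisms_def
    unfolding locally_discrete_simps Hom_locally_discrete vcat_locally_discrete
  proof (rule exI[of _ K], rule exI[of _ A], intro conjI allI impI)
    show "k \<in> Hom C K A" by (rule k)
    fix D s n \<delta> assume "s \<in> Hom C D K \<and> n \<in> Obj (null_cat I D A) \<and>
      \<delta> \<in> Isos (discrete_cat (Arr C)) (k \<cdot>\<^bsub>C\<^esub> s) (null_mor I D A n)"
    then have s: "s \<in> Hom C D K" and n: "n \<in> Obj (null_cat I D A)"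
      and \<delta>: "\<delta> \<in> Isos (discrete_cat (Arr C)) (k \<cdot>\<^bsub>C\<^esub> s) (null_mor I D A n)"
      by auto
    have eq: "n = k \<cdot>\<^bsub>C\<^esub> s" "\<delta> = n" "n \<in> Arr C" "n \<in> N" "n \<in> Hom C D A" using n \<delta> by auto
    then have "s \<in> N" using refl[OF s] by simp
    then show "\<exists>s' \<in> Obj (null_cat I D K). \<exists>\<psi> \<in> Isos (discrete_cat (Arr C)) s (null_mor I D K s').
        is_null_iso I D A n (restr I (Idt C D) k s') (inverse_of (discrete_cat (Arr C)) \<delta>)"
      using s eq nul[OF s] Arr
      by (intro bexI[of _ s]) (auto simp: is_null_iso_def)
  qed
  \<comment> \<open>A 2-cell between null morphisms is the identity of a null morphism, hence an
    arrow of the discrete null category.\<close>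
  show "reflects_null_2cells (locally_discrete C) I k"
    unfolding reflects_null_2cells_def
    by (rule exI[of _ K], rule exI[of _ A]) (auto simp: k is_null_2cell_def)
qed

text \<open>As \<open>f m\<close> is null, \<open>f = g c\<close> for some \<open>g\<close>. If
  \<open>c z\<close> is null, so is \<open>f z = g (c z)\<close>, and \<open>z\<close> factors
  through \<open>m\<close>. Both structure cells are the composite \<open>c m\<close>, so their
  comparison is an identity.\<close>

lemma kernels_normal_locally_discrete:
  fixes C :: "('o, 'a) cat"
  assumes C: "category C" and N: "null_ideal C N" and I: "represents C N I"
  shows "kernels_normal (locally_discrete C) I"
  unfolding kernels_normal_def
proof (intro allI impI, elim conjE)
  interpret category C by fact
  fix f m q \<phi> c n \<alpha>
  assume "two_kernel (locally_discrete C) I f m q \<phi>" "two_cokernel (locally_discrete C) I m c n \<alpha>"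
  then have m: "is_kernel C N f m" and c: "is_kernel (cat_op C) N m c"
    and n: "n = c \<cdot>\<^bsub>C\<^esub> m" "\<alpha> = c \<cdot>\<^bsub>C\<^esub> m"
    using two_kernel_locally_discrete[OF C N I]
      two_kernel_locally_discrete[OF category_cat_op[OF C] null_ideal_op[OF N] represents_op[OF C I]]
    by (auto simp: two_cokernel_def)
  note mt = is_kernel_typed[OF m] and ct = is_kernel_typed[OF c, simplified]
  have dom: "Cod C m = Dom C f" using mt(2) by (simp add: Hom_def)
  have cm: "c \<cdot>\<^bsub>C\<^esub> m \<in> N" using is_kernel_typed(3)[OF c] by simp
  have cmh: "c \<cdot>\<^bsub>C\<^esub> m \<in> Hom C (Dom C m) (Cod C c)" by (rule Comp_in_Hom[OF ct(1,2)])
  have "f \<cdot>\<^bsub>C\<^esub> m \<in> N" by (rule is_kernel_typed(3)[OF m])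
  then obtain g where g: "g \<in> Hom C (Cod C c) (Cod C f)" "g \<cdot>\<^bsub>C\<^esub> c = f"
    using is_kernel_lift[OF c, of f "Cod C f"] mt(1) dom by auto
  have "is_kernel C N c m"
  proof (rule is_kernelI[OF ct(2,1) cm])
    show "\<exists>u \<in> Hom C Z (Dom C m). m \<cdot>\<^bsub>C\<^esub> u = z"
      if z: "z \<in> Hom C Z (Cod C m)" and cz: "c \<cdot>\<^bsub>C\<^esub> z \<in> N" for Z z
    proof -
      have "f \<cdot>\<^bsub>C\<^esub> z \<in> N"
        using null_ideal_compD(2)[OF N cz Comp_in_Hom[OF z ct(2)] g(1)] Comp_assoc[OF z ct(2) g(1)] g(2)
        by simp
      then show ?thesis
        using is_kernel_lift[OF m, of z Z] z dom by auto
    qed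
  qed (rule is_kernel_cancel[OF C N m])
  then have "two_kernel (locally_discrete C) I c m (c \<cdot>\<^bsub>C\<^esub> m) (c \<cdot>\<^bsub>C\<^esub> m)"
    by (simp add: two_kernel_locally_discrete[OF C N I])
  moreover have "is_null_iso I (Dom C m) (Cod C c) n (c \<cdot>\<^bsub>C\<^esub> m)
      (inverse_of (discrete_cat (Arr C)) \<alpha>)"
    using cm cmh n by (simp add: is_null_iso_def representsD[OF I] Hom_def)
  ultimately show "\<exists>n' \<alpha>'. two_kernel (locally_discrete C) I c m n' \<alpha>' \<and>
      is_null_iso I (Dom (locally_discrete C) m) (Cod (locally_discrete C) c) n n'
        (\<alpha>' \<bullet>\<^bsub>locally_discrete C\<^esub> vinv (locally_discrete C) \<alpha>)"
    by auto
qed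

text \<open>Each dual clause is the kernel result over \<open>cat_op C\<close>. The dual 2-ideal
  need not be of the form \<open>discrete_two_ideal\<close> but still represents \<open>N\<close>,
  which is why the kernel results speak of any representing 2-ideal.\<close>

lemma two_exact_wrt_locally_discrete:
  fixes C :: "('o, 'a) cat"
  assumes C: "category C" and N: "exact_wrt C N"
  shows "two_exact_wrt (locally_discrete C) (discrete_two_ideal C N)"
proof -
  let ?I = "discrete_two_ideal C N"
  have cl: "closed_ideal C N" and id: "null_ideal C N"
    using N by (auto simp: exact_wrt_def closed_ideal_def)
  note I = represents_discrete_two_ideal[of C N]
  note C' = category_cat_op[OF C] and cl' = closed_ideal_op[OF cl] and id' = null_ideal_op[OF id]
    and I' = represents_op[OF C I]
  note ker = two_kernel_locally_discrete[OF C id I]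
    and coker = two_kernel_locally_discrete[OF C' id' I']
  have "closed_two_ideal (locally_discrete C) ?I"
    using two_ideal_discrete[OF C id] kernels_reflect_locally_discrete[OF C cl I]
      kernels_reflect_locally_discrete[OF C' cl' I']
    by (simp add: closed_two_ideal_def)
  moreover have "kernels_exist (locally_discrete C) ?I"
    "kernels_exist (two_op (locally_discrete C)) (ideal_op ?I)"
    using N by (auto simp: kernels_exist_def ker coker exact_wrt_def is_cokernel_def)
  moreover have "kernels_normal (locally_discrete C) ?I"
    "kernels_normal (two_op (locally_discrete C)) (ideal_op ?I)"
    using kernels_normal_locally_discrete[OF C id I] kernels_normal_locally_discrete[OF C' id' I']
    by simp_all
  moreover have "\<exists>g e n \<alpha> h m n' \<alpha>'. two_cokernel (locally_discrete C) ?I g e n \<alpha> \<and>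
      two_kernel (locally_discrete C) ?I h m n' \<alpha>' \<and>
      Cod C e = Dom C m \<and> Isos (discrete_cat (Arr C)) f (m \<cdot>\<^bsub>C\<^esub> e) \<noteq> {}"
    if f: "f \<in> Arr C" for f
  proof -
    obtain e m g h where "is_cokernel C N g e" "is_kernel C N h m" "Cod C e = Dom C m"
        "f = m \<cdot>\<^bsub>C\<^esub> e"
      using N f unfolding exact_wrt_def by metis
    moreover from this have "f \<in> Isos (discrete_cat (Arr C)) f (m \<cdot>\<^bsub>C\<^esub> e)" using f by simp
    ultimately show ?thesis
      unfolding two_cokernel_def two_op_locally_discrete ker coker is_cokernel_def by blast
  qed
  ultimately show ?thesis
    by (simp add: two_exact_wrt_def)
qed

section \<open>The zero 2-ideal and bizero objects\<close>

text \<open>\<open>Puppe_2_exact\<close> prescribes its 2-ideal; this identification brings it under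
  the general result for ideals.\<close>

lemma zero_two_ideal_locally_discrete:
  fixes C :: "('o, 'a) cat"
  assumes "category C"
  shows "zero_two_ideal (locally_discrete C) Z = discrete_two_ideal C (zero_morphisms C Z)"
proof -
  interpret category C by fact
  have "{i \<cdot>\<^bsub>C\<^esub> t | i t. t \<in> Hom C A Z \<and> i \<in> Hom C Z B} = zero_morphisms C Z \<inter> Hom C A B" for A B
  proof (intro equalityI subsetI)
    fix n assume "n \<in> {i \<cdot>\<^bsub>C\<^esub> t | i t. t \<in> Hom C A Z \<and> i \<in> Hom C Z B}"
    then show "n \<in> zero_morphisms C Z \<inter> Hom C A B"
      using Comp_in_Hom by (auto simp: zero_morphisms_def)
  next
    fix n assume n: "n \<in> zero_morphisms C Z \<inter> Hom C A B"
    then obtain A' B' i t where "n = i \<cdot>\<^bsub>C\<^esub> t" and t: "t \<in> Hom C A' Z" and i: "i \<in> Hom C Z B'"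
      by (auto simp: zero_morphisms_def)
    \<comment> \<open>\<open>zero_morphisms\<close> ranges over all domains and codomains at once;
      the type of the composite recovers them.\<close>
    moreover from this have "A' = A" "B' = B"
      using Comp_in_Hom[OF t i] n by (auto simp: Hom_def)
    ultimately show "n \<in> {i \<cdot>\<^bsub>C\<^esub> t | i t. t \<in> Hom C A Z \<and> i \<in> Hom C Z B}" by auto
  qed
  \<comment> \<open>Pasting identity 2-cells just composes their 1-cells, so the null 2-cells are
    again the null morphisms.\<close>
  moreover have "{\<iota> \<cdot>\<^bsub>C\<^esub> \<theta> | \<iota> \<theta> t t' i i'. t \<in> Hom C A Z \<and> t' \<in> Hom C A Z \<and>
      \<theta> \<in> Hom (discrete_cat (Arr C)) t t' \<and> i \<in> Hom C Z B \<and> i' \<in> Hom C Z B \<and>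
      \<iota> \<in> Hom (discrete_cat (Arr C)) i i'} = {i \<cdot>\<^bsub>C\<^esub> t | i t. t \<in> Hom C A Z \<and> i \<in> Hom C Z B}" for A B
    by (auto simp: Hom_def)
  ultimately have "zero_null_cat (locally_discrete C) Z A B =
      discrete_cat (zero_morphisms C Z \<inter> Hom C A B)" for A B
    by (simp add: zero_null_cat_def discrete_cat_def)
  then show ?thesis
    by (simp add: zero_two_ideal_def discrete_two_ideal_def discrete_pfunctor_def)
qed

lemma bizero_locally_discrete:
  assumes "zero_object C Z"
  shows "bizero (locally_discrete C) Z"
proof -
  have "equivalent_cats (discrete_cat (Hom C A Z)) terminal_cat \<and>
      equivalent_cats (discrete_cat (Hom C Z A)) terminal_cat" if "A \<in> Obj C" for A
  proof -
    have singleton: "\<exists>x. S = {x}" if "\<exists>!x. x \<in> S" for S :: "'b set"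
      using that by auto
    have "\<exists>!t. t \<in> Hom C A Z" "\<exists>!i. i \<in> Hom C Z A"
      using assms that by (simp_all add: zero_object_def)
    then obtain t i where "Hom C A Z = {t}" "Hom C Z A = {i}"
      using singleton by meson
    then show ?thesis
      by (simp add: equivalent_discrete_terminal)
  qed
  then show ?thesis
    using assms by (simp add: bizero_def zero_object_def)
qed

lemma Grandis_exact_2_exact:
  assumes "Grandis_exact C"
  shows "Grandis_2_exact (locally_discrete C)"
  using assms two_exact_wrt_locally_discrete two_category_locally_discrete
  unfolding Grandis_exact_def Grandis_2_exact_def by blast

lemma Puppe_exact_2_exact:
  assumes "Puppe_exact C"
  shows "Puppe_2_exact (locally_discrete C)"
  using assms two_exact_wrt_locally_discrete two_category_locally_discrete bizero_locally_discrete
  unfolding Puppe_exact_def Puppe_2_exact_def by (metis zero_two_ideal_locally_discrete)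

section \<open>Abelian categories\<close>

text \<open>The factorization through \<open>Z\<close> is built into the definition, and
  \<open>Idt C Z\<close>, being its own square, is a zero morphism.\<close>

lemma closed_ideal_zero_morphisms:
  fixes C :: "('o, 'a) cat"
  assumes "category C" and Z: "Z \<in> Obj C"
  shows "closed_ideal C (zero_morphisms C Z)"
proof -
  interpret category C by fact
  have zero: "i \<cdot>\<^bsub>C\<^esub> t \<in> zero_morphisms C Z" if "t \<in> Hom C A Z" "i \<in> Hom C Z B" for A B i t
    using that by (auto simp: zero_morphisms_def)
  have "Idt C Z \<in> zero_morphisms C Z"
    using zero[OF Idt_in_Hom Idt_in_Hom] Z Comp_Idt[OF Idt_in_Hom] by metis
  moreover have "null_ideal C (zero_morphisms C Z)"
    unfolding null_ideal_def
  proof (intro conjI ballI subsetI impI)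
    fix n assume "n \<in> zero_morphisms C Z"
    then obtain A B i t where t: "t \<in> Hom C A Z" and i: "i \<in> Hom C Z B" and n: "n = i \<cdot>\<^bsub>C\<^esub> t"
      by (auto simp: zero_morphisms_def)
    have nh: "n \<in> Hom C A B" using Comp_in_Hom[OF t i] n by simp
    then show "n \<in> Arr C" by (simp add: Hom_def)
    show "n \<cdot>\<^bsub>C\<^esub> a \<in> zero_morphisms C Z" if "a \<in> Arr C" "Cod C a = Dom C n" for a
    proof -
      have a: "a \<in> Hom C (Dom C a) A" using that nh by (simp add: Hom_def)
      show ?thesis using zero[OF Comp_in_Hom[OF a t] i] Comp_assoc[OF a t i] n by simp
    qed
    show "b \<cdot>\<^bsub>C\<^esub> n \<in> zero_morphisms C Z" if "b \<in> Arr C" "Dom C b = Cod C n" for b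
    proof -
      have b: "b \<in> Hom C B (Cod C b)" using that nh by (simp add: Hom_def)
      show ?thesis using zero[OF t Comp_in_Hom[OF i b]] Comp_assoc[OF t i b] n by simp
    qed
  qed
  moreover have "\<exists>a \<in> Hom C (Dom C n) Z. \<exists>b \<in> Hom C Z (Cod C n). n = b \<cdot>\<^bsub>C\<^esub> a"
    if n: "n \<in> zero_morphisms C Z" for n
  proof -
    obtain A B i t where t: "t \<in> Hom C A Z" and i: "i \<in> Hom C Z B" and "n = i \<cdot>\<^bsub>C\<^esub> t"
      using n by (auto simp: zero_morphisms_def)
    moreover have "i \<cdot>\<^bsub>C\<^esub> t \<in> Hom C A B" by (rule Comp_in_Hom[OF t i])
    ultimately show ?thesis by (auto simp: Hom_def)
  qed
  ultimately show ?thesis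
    using Z by (auto simp: closed_ideal_def)
qed

section \<open>Hom-group arithmetic and a test for epimorphisms\<close>

context preadditive
begin

lemma Hom_Obj: "f \<in> Hom C A B \<Longrightarrow> A \<in> Obj C \<and> B \<in> Obj C"
  using Dom_in_Obj Cod_in_Obj by (auto simp: Hom_def)

lemma Hom_group: "A \<in> Obj C \<Longrightarrow> B \<in> Obj C \<Longrightarrow>
    group \<lparr>carrier = Hom C A B, monoid.mult = add, one = nul A B\<rparr>"
  by (rule comm_group.axioms(2)[OF Hom_abelian_group])

lemma nul_in_Hom: "A \<in> Obj C \<Longrightarrow> B \<in> Obj C \<Longrightarrow> nul A B \<in> Hom C A B"
  using Hom_group[THEN group.is_monoid, THEN monoid.one_closed]
  by auto

lemma add_in_Hom: "f \<in> Hom C A B \<Longrightarrow> g \<in> Hom C A B \<Longrightarrow> add f g \<in> Hom C A B"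
  using Hom_Obj[of f A B]
    Hom_group[THEN group.is_monoid, THEN monoid.m_closed, of A B f g]
  by auto

lemma add_nul: "f \<in> Hom C A B \<Longrightarrow> add f (nul A B) = f"
  using Hom_Obj[of f A B]
    Hom_group[THEN group.is_monoid, THEN monoid.r_one, of A B f]
  by auto

text \<open>Bilinearity makes a composite with a zero additively idempotent; this shows that it
  vanishes.\<close>

lemma add_idem_nul: "f \<in> Hom C A B \<Longrightarrow> add f f = f \<Longrightarrow> f = nul A B"
  using Hom_Obj[of f A B] group.l_cancel_one[OF Hom_group, of A B f f] by auto

lemma add_right_cancel:
  assumes "f \<in> Hom C A B" "g \<in> Hom C A B" "h \<in> Hom C A B"
  shows "add g f = add h f \<longleftrightarrow> g = h"
  using Hom_Obj[OF assms(1)] assms group.right_cancel[OF Hom_group, of A B f g h] by auto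

lemma add_inverse_ex: "f \<in> Hom C A B \<Longrightarrow> \<exists>g \<in> Hom C A B. add f g = nul A B"
  using Hom_Obj[of f A B] group.r_inv_ex[OF Hom_group, of A B f]
  by auto

lemma Comp_nul:
  assumes "A \<in> Obj C" and h: "h \<in> Hom C B D"
  shows "h \<cdot> nul A B = nul A D"
proof -
  have n: "nul A B \<in> Hom C A B" using nul_in_Hom assms Hom_Obj[OF h] by simp
  have hn: "h \<cdot> nul A B \<in> Hom C A D" by (rule Comp_in_Hom[OF n h])
  have "add (h \<cdot> nul A B) (h \<cdot> nul A B) = h \<cdot> nul A B"
    using Comp_add[OF n n h] add_nul[OF n] by simp
  then show ?thesis by (rule add_idem_nul[OF hn])
qed

lemma nul_Comp:
  assumes "D \<in> Obj C" and f: "f \<in> Hom C A B"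
  shows "nul B D \<cdot> f = nul A D"
proof -
  have n: "nul B D \<in> Hom C B D" using nul_in_Hom assms Hom_Obj[OF f] by simp
  have nf: "nul B D \<cdot> f \<in> Hom C A D" by (rule Comp_in_Hom[OF f n])
  have "add (nul B D \<cdot> f) (nul B D \<cdot> f) = nul B D \<cdot> f"
    using add_Comp[OF f n n] add_nul[OF n] by simp
  then show ?thesis by (rule add_idem_nul[OF nf])
qed

text \<open>This bridges the ideal used for kernels and the additive zeros. A leg into
  \<open>Z\<close> must be \<open>nul A Z\<close> by uniqueness, and conversely
  \<open>nul A B\<close> is the composite of zeros through \<open>Z\<close>.\<close>

lemma zero_morphisms_iff_nul:
  assumes Z: "zero_object C Z" and f: "f \<in> Hom C A B"
  shows "f \<in> zero_morphisms C Z \<longleftrightarrow> f = nul A B"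
proof
  have ob: "A \<in> Obj C" "B \<in> Obj C" "Z \<in> Obj C"
    using Hom_Obj[OF f] Z by (auto simp: zero_object_def)
  {
    assume "f \<in> zero_morphisms C Z"
    then obtain A' B' i t where t: "t \<in> Hom C A' Z" and i: "i \<in> Hom C Z B'" and "f = i \<cdot> t"
      by (auto simp: zero_morphisms_def)
    moreover from this have "A' = A" "B' = B"
      using Comp_in_Hom[OF t i] f by (auto simp: Hom_def)
    moreover from this have "t = nul A Z"
      using Z t ob nul_in_Hom[of A Z] unfolding zero_object_def by blast
    ultimately show "f = nul A B" using Comp_nul ob by simp
  next
    assume "f = nul A B"
    then have "f = nul Z B \<cdot> nul A Z"
      using Comp_nul[OF ob(1) nul_in_Hom[OF ob(3,2)]] by simp
    then show "f \<in> zero_morphisms C Z"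
      using nul_in_Hom ob unfolding zero_morphisms_def by blast
  }
qed

lemma epicI:
  assumes e: "e \<in> Hom C A B"
    and nul: "\<And>D x. x \<in> Hom C B D \<Longrightarrow> x \<cdot> e = nul A D \<Longrightarrow> x = nul B D"
  shows "epic C e"
  unfolding epic_def monic_def
proof (intro conjI allI ballI impI)
  show "e \<in> Arr (cat_op C)" using e by (simp add: Hom_def)
  fix D u v
  assume "u \<in> Hom (cat_op C) D (Dom (cat_op C) e)" "v \<in> Hom (cat_op C) D (Dom (cat_op C) e)"
    and "e \<cdot>\<^bsub>cat_op C\<^esub> u = e \<cdot>\<^bsub>cat_op C\<^esub> v"
  then have u: "u \<in> Hom C B D" and v: "v \<in> Hom C B D" and eq: "u \<cdot> e = v \<cdot> e"
    using e by (auto simp: Hom_def)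
  \<comment> \<open>With \<open>w\<close> the additive inverse of \<open>v\<close>, the sum
    \<open>add u w\<close> stands for the difference of \<open>u\<close> and \<open>v\<close>, to
    which the assumption on \<open>e\<close> applies.\<close>
  obtain w where w: "w \<in> Hom C B D" "add v w = nul B D" using add_inverse_ex[OF v] by blast
  have "add u w \<cdot> e = add v w \<cdot> e"
    using add_Comp[OF e u w(1)] add_Comp[OF e v w(1)] eq by simp
  then have "add u w \<cdot> e = nul A D" using w(2) nul_Comp[OF _ e] Hom_Obj[OF u] by simp
  then have "add u w = add v w" using nul[OF add_in_Hom[OF u w(1)]] w(2) by simp
  then show "u = v" using add_right_cancel[OF w(1) u v] by simp
qed

end

section \<open>Abelian categories are Puppe exact\<close>

lemma abelian_category_Puppe_exact:
  fixes C :: "('o, 'a) cat"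
  assumes "abelian_category C"
  shows "Puppe_exact C"
proof -
  obtain add nul Z where P: "preadditive C add nul" and Z: "zero_object C Z"
    and ker: "\<And>f. f \<in> Arr C \<Longrightarrow> \<exists>k. is_kernel C (zero_morphisms C Z) f k"
    and coker: "\<And>f. f \<in> Arr C \<Longrightarrow> \<exists>c. is_cokernel C (zero_morphisms C Z) f c"
    and monic: "\<And>m. monic C m \<Longrightarrow> \<exists>f. is_kernel C (zero_morphisms C Z) f m"
    and epic: "\<And>e. epic C e \<Longrightarrow> \<exists>f. is_cokernel C (zero_morphisms C Z) f e"
    using assms unfolding abelian_category_def by metis
  interpret preadditive C add nul by fact
  let ?N = "zero_morphisms C Z"
  note C = category_axioms
  have cl: "closed_ideal C ?N"
    by (rule closed_ideal_zero_morphisms[OF C]) (use Z in \<open>simp add: zero_object_def\<close>)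
  then have N: "null_ideal C ?N" by (simp add: closed_ideal_def)
  have "\<exists>e m g h. is_cokernel C ?N g e \<and> is_kernel C ?N h m \<and> Cod C e = Dom C m \<and> f = m \<cdot>\<^bsub>C\<^esub> e"
    if "f \<in> Arr C" for f
  proof -
    obtain c where c: "is_kernel (cat_op C) ?N f c"
      using coker[OF \<open>f \<in> Arr C\<close>] by (auto simp: is_cokernel_def)
    define A B D where "A = Dom C f" and "B = Cod C f" and "D = Cod C c"
    have f: "f \<in> Hom C A B" and ch: "c \<in> Hom C B D" and cf: "c \<cdot>\<^bsub>C\<^esub> f \<in> ?N"
      using is_kernel_typed[OF c] by (simp_all add: A_def B_def D_def)
    \<comment> \<open>This kernel of the cokernel is the image of \<open>f\<close>.\<close>
    obtain m where m: "is_kernel C ?N c m"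
      using ker ch by (auto simp: Hom_def)
    define M where "M = Dom C m"
    have mh: "m \<in> Hom C M B" and cm: "c \<cdot>\<^bsub>C\<^esub> m \<in> ?N"
      using is_kernel_typed[OF m] ch by (simp_all add: M_def Hom_def)
    obtain e where e: "e \<in> Hom C A M" "m \<cdot>\<^bsub>C\<^esub> e = f"
      using is_kernel_lift[OF m, of f A] f ch cf by (auto simp: M_def Hom_def)
    have "epic C e"
    proof (rule epicI[OF e(1)])
      fix X x assume x: "x \<in> Hom C M X" and xe: "x \<cdot>\<^bsub>C\<^esub> e = nul A X"
      obtain k where k: "is_kernel C ?N x k" using ker x by (auto simp: Hom_def)
      define K where "K = Dom C k"
      have kh: "k \<in> Hom C K M" and xk: "x \<cdot>\<^bsub>C\<^esub> k \<in> ?N"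
        using is_kernel_typed[OF k] x by (simp_all add: K_def Hom_def)
      have "x \<cdot>\<^bsub>C\<^esub> e \<in> ?N"
        using zero_morphisms_iff_nul[OF Z Comp_in_Hom[OF e(1) x]] xe by simp
      then obtain e' where e': "e' \<in> Hom C A K" "k \<cdot>\<^bsub>C\<^esub> e' = e"
        using is_kernel_lift[OF k, of e A] e(1) x by (auto simp: K_def Hom_def)
      have mk: "m \<cdot>\<^bsub>C\<^esub> k \<in> Hom C K B" by (rule Comp_in_Hom[OF kh mh])
      \<comment> \<open>Both factors are kernels, hence cancellable one after the other.\<close>
      have "monic C (m \<cdot>\<^bsub>C\<^esub> k)"
        unfolding monic_def
      proof (intro conjI allI ballI impI)
        show "m \<cdot>\<^bsub>C\<^esub> k \<in> Arr C" using mk by (simp add: Hom_def)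
        fix Y u v assume "u \<in> Hom C Y (Dom C (m \<cdot>\<^bsub>C\<^esub> k))" "v \<in> Hom C Y (Dom C (m \<cdot>\<^bsub>C\<^esub> k))"
          and eq: "m \<cdot>\<^bsub>C\<^esub> k \<cdot>\<^bsub>C\<^esub> u = m \<cdot>\<^bsub>C\<^esub> k \<cdot>\<^bsub>C\<^esub> v"
        then have u: "u \<in> Hom C Y K" and v: "v \<in> Hom C Y K"
          using mk by (auto simp: Hom_def)
        have "k \<cdot>\<^bsub>C\<^esub> u = k \<cdot>\<^bsub>C\<^esub> v"
          using is_kernel_cancel[OF C N m, of "k \<cdot>\<^bsub>C\<^esub> u" Y "k \<cdot>\<^bsub>C\<^esub> v"] eq Comp_in_Hom[OF u kh]
            Comp_in_Hom[OF v kh] Comp_assoc[OF u kh mh] Comp_assoc[OF v kh mh] by (simp add: M_def)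
        then show "u = v"
          using is_kernel_cancel[OF C N k, of u Y v] u v by (simp add: K_def)
      qed
      then obtain h where h: "is_kernel C ?N h (m \<cdot>\<^bsub>C\<^esub> k)" using monic by blast
      define H where "H = Cod C h"
      have hh: "h \<in> Hom C B H" and hmk: "h \<cdot>\<^bsub>C\<^esub> (m \<cdot>\<^bsub>C\<^esub> k) \<in> ?N"
        using is_kernel_typed[OF h] mk by (simp_all add: H_def Hom_def)
      \<comment> \<open>Here \<open>f = m e = m k e'\<close>, so \<open>h\<close> kills
        \<open>f\<close> because it kills \<open>m k\<close>.\<close>
      have "h \<cdot>\<^bsub>C\<^esub> f = h \<cdot>\<^bsub>C\<^esub> (m \<cdot>\<^bsub>C\<^esub> k) \<cdot>\<^bsub>C\<^esub> e'"
        using e e' by (metis Comp_assoc kh mh mk hh)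
      then have "h \<cdot>\<^bsub>C\<^esub> f \<in> ?N"
        using null_ideal_compD(1)[OF N hmk Comp_in_Hom[OF mk hh] e'(1)] by simp
      then obtain h' where h': "h' \<in> Hom C D H" "h' \<cdot>\<^bsub>C\<^esub> c = h"
        using is_kernel_lift[OF c, of h H] hh f by (auto simp: D_def Hom_def)
      \<comment> \<open>Write \<open>h m = h' (c m)\<close>, where \<open>c m\<close> is
        null.\<close>
      have "h \<cdot>\<^bsub>C\<^esub> m \<in> ?N"
        using null_ideal_compD(2)[OF N cm Comp_in_Hom[OF mh ch] h'(1)] Comp_assoc[OF mh ch h'(1)] h'(2)
        by simp
      then obtain w where w: "w \<in> Hom C M K" "m \<cdot>\<^bsub>C\<^esub> k \<cdot>\<^bsub>C\<^esub> w = m"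
        using is_kernel_lift[OF h, of m M] mh hh mk by (auto simp: Hom_def)
      have M: "M \<in> Obj C" using Hom_Obj[OF mh] by simp
      have "k \<cdot>\<^bsub>C\<^esub> w = Idt C M"
        using is_kernel_cancel[OF C N m, of "k \<cdot>\<^bsub>C\<^esub> w" M "Idt C M"] Comp_in_Hom[OF w(1) kh]
          Idt_in_Hom[OF M] Comp_Idt[OF mh] Comp_assoc[OF w(1) kh mh] w(2) by (simp add: M_def)
      \<comment> \<open>A section of \<open>k\<close> exhibits \<open>x\<close> as
        \<open>(x k) w\<close>, and \<open>x k\<close> is null.\<close>
      then have "x = x \<cdot>\<^bsub>C\<^esub> k \<cdot>\<^bsub>C\<^esub> w"
        using Comp_assoc[OF w(1) kh x] Comp_Idt[OF x] by simp
      then have "x \<in> ?N"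
        using null_ideal_compD(1)[OF N xk Comp_in_Hom[OF kh x] w(1)] by simp
      then show "x = nul M X" using zero_morphisms_iff_nul[OF Z x] by simp
    qed
    then obtain g where "is_cokernel C ?N g e" using epic by blast
    moreover have "Cod C e = Dom C m" using e(1) by (simp add: M_def Hom_def)
    ultimately show ?thesis using m e(2) by blast
  qed
  then have "exact_wrt C ?N"
    using cl ker coker by (simp add: exact_wrt_def)
  then show ?thesis using C Z by (auto simp: Puppe_exact_def)
qed

theorem corollary3p14:
  fixes C :: "('o, 'a) cat"
  shows "(Grandis_exact C \<longrightarrow> Grandis_2_exact (locally_discrete C)) \<and>
         (Puppe_exact C \<longrightarrow> Puppe_2_exact (locally_discrete C)) \<and>
         (abelian_category C \<longrightarrow> Puppe_2_exact (locally_discrete C))"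
  using Grandis_exact_2_exact Puppe_exact_2_exact abelian_category_Puppe_exact by blast

end
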